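(* Let $\mathbb{F}$ be a field, let $G$ be a group and let $S$ be an index $2$ subgroup of $G$. Then the cohomology group $H^3(G,\mathbb{F}^\times)$, where $\mathbb{F}^\times$ is regarded as a trivial $G$-module, is in one-to-one correspondence with überderivations on $S$ over $\mathbb{F}^{G\setminus S}$ up to gauge equivalence.
   Context: Let $M=G\setminus S$ and $B=\mathbb{F}^M$, a ring under pointwise operations. Write $\bar g=g^{-1}$. For $\mu\in B$ and $a,b\in S$ define ${}^a\mu^b,\bar\mu\in B$ by ${}^a\mu^b(m)=\mu(\bar am\bar b)$ and $\bar\mu(m)=\mu(\bar m)$ for $m\in M$; ${}^a\mu$ and $\mu^b$ are the cases $b=1$ and $a=1$. For $B$-valued functions $\epsilon$ these operations apply to values: ${}^a\epsilon^b(x)={}^a(\epsilon(x))^b$ and $\bar\epsilon(x)=\overline{\epsilon(x)}$; $\mu\,{}^a\nu$ means $\mu\cdot({}^a\nu)$. An überderivation on $S$ over $B$ is a triple $(\chi,\upsilon,\tau)$ with $\chi,\upsilon\colon S\times S\to B^\times$ and $\tau\in B^\times$ such that $\upsilon$ is normalized ($\upsilon(1,a)=\upsilon(a,1)=1$ for $a\in S$) and for all $a,b,c\in S$ $$\bar\chi(b,a)={}^{\bar a}\chi^{\bar b}(a,b)\,\frac{{}^{\bar a}\tau^{\bar b}\cdot\tau}{{}^{\bar a}\tau\cdot\tau^{\bar b}},\qquad \frac{\upsilon(a,b)}{\upsilon^c(a,b)}\,\chi(ab,c)=\chi(a,c)\cdot{}^a\chi(b,c);$$ the set $A$ of elements of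 $S$ acting trivially on $B$ is finite; the restriction $\chi|_{A\times A}$, which is a symmetric bicharacter ($\chi(b,a)=\chi(a,b)$, $\chi(ab,c)=\chi(a,c)\chi(b,c)$), is nondegenerate, i.e. $\sum_{b\in A}\chi(a,b)=0$ for $1\neq a\in A$; and $|A|\tau\bar\tau=1_B$. (In the present situation $A=\{1\}$.) Let $\mathrm{fix}(S)$ be the set of elements of $B$ fixed under the left and right $S$-actions. A gauge transformation from $(\chi,\upsilon,\tau)$ to another überderivation $(\tilde\chi,\tilde\upsilon,\tilde\tau)$ is a triple $(\theta,\phi,\varsigma)\in\mathrm{fix}(S)^{S\times S}\times(B^\times)^S\times B^\times$ with $\phi(1)=1$ such that for $a,b\in S$ $$\frac{\tilde\chi(a,b)}{\chi(a,b)}=\frac{\phi(a)\cdot{}^a\bar\phi^b(b)\cdot{}^a\varsigma^b\cdot\varsigma}{\phi^b(a)\cdot\bar\phi^b(b)\cdot{}^a\varsigma\cdot\varsigma^b},\qquad \frac{\tilde\upsilon(a,b)}{\upsilon(a,b)}=\frac{\phi(a)\cdot{}^a\phi(b)}{\phi(ab)\,\theta(a,b)},\qquad \frac{\tilde\tau}{\tau}=\frac{\bar\varsigma}{\varsigma}.$$ Überderivations related by a gauge transformation are called gauge equivalent. *)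

theory Defs
  imports "HOL-Algebra.Algebra" "HOL-Algebra.Product_Groups" "HOL-Algebra.Algebraic_Closure_Type"
begin

section \<open>Third cohomology of a group with trivial coefficients\<close>

text \<open>Inhomogeneous cochains of a group \<open>G\<close> with values in an abelian group \<open>A\<close>, written
  multiplicatively, on which \<open>G\<close> acts trivially.\<close>

context
  fixes G :: "('g, 'x) monoid_scheme" (structure) and A :: "('a, 'y) monoid_scheme"
begin

definition cochains2 :: "('g \<times> 'g \<Rightarrow> 'a) monoid" where
  "cochains2 = product_group (carrier G \<times> carrier G) (\<lambda>_. A)"

definition cochains3 :: "('g \<times> 'g \<times> 'g \<Rightarrow> 'a) monoid" where
  "cochains3 = product_group (carrier G \<times> carrier G \<times> carrier G) (\<lambda>_. A)"

definition cochains4 :: "('g \<times> 'g \<times> 'g \<times> 'g \<Rightarrow> 'a) monoid" where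
  "cochains4 = product_group (carrier G \<times> carrier G \<times> carrier G \<times> carrier G) (\<lambda>_. A)"

definition coboundary2 :: "('g \<times> 'g \<Rightarrow> 'a) \<Rightarrow> 'g \<times> 'g \<times> 'g \<Rightarrow> 'a" where
  "coboundary2 f = (\<lambda>(x, y, z) \<in> carrier G \<times> carrier G \<times> carrier G.
     f (y, z) \<otimes>\<^bsub>A\<^esub> inv\<^bsub>A\<^esub> f (x \<otimes> y, z) \<otimes>\<^bsub>A\<^esub> f (x, y \<otimes> z) \<otimes>\<^bsub>A\<^esub> inv\<^bsub>A\<^esub> f (x, y))"

definition coboundary3 :: "('g \<times> 'g \<times> 'g \<Rightarrow> 'a) \<Rightarrow> 'g \<times> 'g \<times> 'g \<times> 'g \<Rightarrow> 'a" where
  "coboundary3 f = (\<lambda>(x, y, z, w) \<in> carrier G \<times> carrier G \<times> carrier G \<times> carrier G.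
     f (y, z, w) \<otimes>\<^bsub>A\<^esub> inv\<^bsub>A\<^esub> f (x \<otimes> y, z, w) \<otimes>\<^bsub>A\<^esub> f (x, y \<otimes> z, w)
       \<otimes>\<^bsub>A\<^esub> inv\<^bsub>A\<^esub> f (x, y, z \<otimes> w) \<otimes>\<^bsub>A\<^esub> f (x, y, z))"

definition cohomology3 :: "('g \<times> 'g \<times> 'g \<Rightarrow> 'a) set monoid" where
  "cohomology3 =
     (cochains3\<lparr>carrier := kernel cochains3 cochains4 coboundary3\<rparr>) Mod
       (coboundary2 ` carrier cochains2)"

end

definition field_units :: "'f::field monoid" where
  "field_units = mult_of ring_of_type_algebra"


section \<open>Ueberderivations\<close>

text \<open>Throughout, \<open>M = carrier G - S\<close>. The ring \<open>B\<close> of functions from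
  \<open>M\<close> to the field is \<open>coeff_ring\<close>; its elements are functions on the whole type that are
  \<open>undefined\<close> outside \<open>M\<close>, so that equality in \<open>B\<close> is equality on \<open>M\<close>.\<close>

context
  fixes G :: "('g, 'x) monoid_scheme" (structure) and S :: "'g set"
begin

private abbreviation (input) M where "M \<equiv> carrier G - S"

definition coeff_ring :: "('g \<Rightarrow> 'f::field) ring" where
  "coeff_ring = \<lparr>carrier = M \<rightarrow>\<^sub>E UNIV,
        monoid.mult = (\<lambda>\<mu> \<nu>. \<lambda>m\<in>M. \<mu> m * \<nu> m), one = (\<lambda>m\<in>M. 1),
        ring.zero = (\<lambda>m\<in>M. 0), add = (\<lambda>\<mu> \<nu>. \<lambda>m\<in>M. \<mu> m + \<nu> m)\<rparr>"

text \<open>\<open>act a \<mu> b\<close> is \<open>\<mu>\<close> with \<open>a\<close> as left and \<open>b\<close> as right superscript; \<open>act a \<mu> \<one>\<close> and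
  \<open>act \<one> \<mu> b\<close> are the one-sided actions.\<close>

definition act :: "'g \<Rightarrow> ('g \<Rightarrow> 'f::field) \<Rightarrow> 'g \<Rightarrow> 'g \<Rightarrow> 'f" where
  "act a \<mu> b = (\<lambda>m\<in>M. \<mu> (inv a \<otimes> m \<otimes> inv b))"

definition bar :: "('g \<Rightarrow> 'f::field) \<Rightarrow> 'g \<Rightarrow> 'f" where
  "bar \<mu> = (\<lambda>m\<in>M. \<mu> (inv m))"

text \<open>The argument \<open>V\<close> is always \<open>carrier coeff_ring\<close>; it is a parameter because it determines the
  coefficient field.\<close>

definition trivially_acting :: "('g \<Rightarrow> 'f::field) set \<Rightarrow> 'g set" where
  "trivially_acting V = {a \<in> S. \<forall>\<mu>\<in>V. act a \<mu> \<one> = \<mu> \<and> act \<one> \<mu> a = \<mu>}"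

definition fixed_functions :: "('g \<Rightarrow> 'f::field) set" where
  "fixed_functions = {\<mu> \<in> carrier coeff_ring. \<forall>a\<in>S. act a \<mu> \<one> = \<mu> \<and> act \<one> \<mu> a = \<mu>}"

text \<open>Equations in \<open>B\<close> are written out pointwise on \<open>M\<close>. All denominators are units of \<open>B\<close>, hence
  nonzero at every point. That \<open>\<chi>\<close> restricts to a symmetric bicharacter on \<open>A\<close> follows from the
  other conditions and is therefore not listed.\<close>

definition ueberderivations ::
    "(('g \<times> 'g \<Rightarrow> 'g \<Rightarrow> 'f::field) \<times> ('g \<times> 'g \<Rightarrow> 'g \<Rightarrow> 'f) \<times> ('g \<Rightarrow> 'f)) set" where
  "ueberderivations = {(\<chi>, \<upsilon>, \<tau>).
     \<chi> \<in> S \<times> S \<rightarrow>\<^sub>E Units coeff_ring \<and> \<upsilon> \<in> S \<times> S \<rightarrow>\<^sub>E Units coeff_ring \<and>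
     \<tau> \<in> Units coeff_ring \<and>
     (\<forall>a\<in>S. \<upsilon> (\<one>, a) = \<one>\<^bsub>coeff_ring\<^esub> \<and> \<upsilon> (a, \<one>) = \<one>\<^bsub>coeff_ring\<^esub>) \<and>
     (\<forall>a\<in>S. \<forall>b\<in>S. \<forall>m\<in>M.
        bar (\<chi> (b, a)) m =
          act (inv a) (\<chi> (a, b)) (inv b) m *
            ((act (inv a) \<tau> (inv b) m * \<tau> m) / (act (inv a) \<tau> \<one> m * act \<one> \<tau> (inv b) m))) \<and>
     (\<forall>a\<in>S. \<forall>b\<in>S. \<forall>c\<in>S. \<forall>m\<in>M.
        \<upsilon> (a, b) m / act \<one> (\<upsilon> (a, b)) c m * \<chi> (a \<otimes> b, c) m =
          \<chi> (a, c) m * act a (\<chi> (b, c)) \<one> m) \<and>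
     (let A = trivially_acting (carrier coeff_ring :: ('g \<Rightarrow> 'f) set) in
        finite A \<and>
        (\<forall>a\<in>A - {\<one>}. \<forall>m\<in>M. (\<Sum>b\<in>A. \<chi> (a, b) m) = 0) \<and>
        (\<forall>m\<in>M. of_nat (card A) * \<tau> m * bar \<tau> m = 1))}"

text \<open>Since \<open>\<theta>\<close> occurs as a divisor, its values are required to be units.\<close>

definition gauge_transformation ::
    "('g \<times> 'g \<Rightarrow> 'g \<Rightarrow> 'f::field) \<times> ('g \<Rightarrow> 'g \<Rightarrow> 'f) \<times> ('g \<Rightarrow> 'f) \<Rightarrow>
     ('g \<times> 'g \<Rightarrow> 'g \<Rightarrow> 'f) \<times> ('g \<times> 'g \<Rightarrow> 'g \<Rightarrow> 'f) \<times> ('g \<Rightarrow> 'f) \<Rightarrow>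
     ('g \<times> 'g \<Rightarrow> 'g \<Rightarrow> 'f) \<times> ('g \<times> 'g \<Rightarrow> 'g \<Rightarrow> 'f) \<times> ('g \<Rightarrow> 'f) \<Rightarrow> bool" where
  "gauge_transformation = (\<lambda>(\<theta>, \<phi>, \<sigma>) (\<chi>, \<upsilon>, \<tau>) (\<chi>', \<upsilon>', \<tau>').
     \<theta> \<in> S \<times> S \<rightarrow>\<^sub>E fixed_functions \<inter> Units coeff_ring \<and> \<phi> \<in> S \<rightarrow>\<^sub>E Units coeff_ring \<and>
     \<sigma> \<in> Units coeff_ring \<and> \<phi> \<one> = \<one>\<^bsub>coeff_ring\<^esub> \<and>
     (\<forall>a\<in>S. \<forall>b\<in>S. \<forall>m\<in>M.
        \<chi>' (a, b) m / \<chi> (a, b) m =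
          (\<phi> a m * act a (bar (\<phi> b)) b m * act a \<sigma> b m * \<sigma> m) /
          (act \<one> (\<phi> a) b m * act \<one> (bar (\<phi> b)) b m * act a \<sigma> \<one> m * act \<one> \<sigma> b m)) \<and>
     (\<forall>a\<in>S. \<forall>b\<in>S. \<forall>m\<in>M.
        \<upsilon>' (a, b) m / \<upsilon> (a, b) m =
          (\<phi> a m * act a (\<phi> b) \<one> m) / (\<phi> (a \<otimes> b) m * \<theta> (a, b) m)) \<and>
     (\<forall>m\<in>M. \<tau>' m / \<tau> m = bar \<sigma> m / \<sigma> m))"

definition gauge_equivalence ::
    "((('g \<times> 'g \<Rightarrow> 'g \<Rightarrow> 'f::field) \<times> ('g \<times> 'g \<Rightarrow> 'g \<Rightarrow> 'f) \<times> ('g \<Rightarrow> 'f)) \<times>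
      (('g \<times> 'g \<Rightarrow> 'g \<Rightarrow> 'f) \<times> ('g \<times> 'g \<Rightarrow> 'g \<Rightarrow> 'f) \<times> ('g \<Rightarrow> 'f))) set" where
  "gauge_equivalence = {(u, u'). u \<in> ueberderivations \<and> u' \<in> ueberderivations \<and>
     (\<exists>t. gauge_transformation t u u')}"

end

end

theory Submission
  imports Defs
begin

text \<open>A third cohomology class of \<open>G\<close> has a representative of a special shape, and an ueberderivation is
  the list of those values of the representative that determine it.

  Let \<open>M\<close> be the nontrivial coset of \<open>S\<close>, and let \<open>w\<close> be a 3-cocycle. Multiplying \<open>w\<close> by a coboundary
  makes it normalized and trivial at all triples \<open>(a, inv m, m)\<close> and \<open>(inv m, m, a)\<close> with \<open>a \<in> S\<close> and
  \<open>m \<in> M\<close> (\<open>exists_reduced\<close>). For such a reduced cocycle, the cocycle condition expresses every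
  value by the functions \<open>\<upsilon> (a, b) (a \<otimes> b \<otimes> m) = w (a, b, m)\<close>, \<open>\<chi> (a, b) (a \<otimes> m \<otimes> b) = w (a, m, b)\<close> and
  \<open>\<tau> m = w (inv m, m, inv m)\<close>. These functions form an ueberderivation: multiplicativity of \<open>\<chi>\<close> up to
  \<open>\<upsilon>\<close> is the cocycle condition at \<open>(a, b, m, c)\<close>, the law for exchanging the arguments of \<open>\<chi>\<close> compares
  two expressions for \<open>w (m, a, n)\<close>, and \<open>\<tau> m * \<tau> (inv m) = 1\<close> is the condition at
  \<open>(inv m, m, inv m, m)\<close>; see \<open>pointwise_ueberderivation_components\<close>. Conversely, for every
  ueberderivation the expressions for the values define a reduced cocycle; this is the main
  computation (\<open>cocycle_assemble\<close>), with one case for each choice of cosets of the four arguments.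
  Hence ueberderivations and reduced cocycles are the same thing.

  Two reduced cocycles are cohomologous if and only if their ueberderivations are gauge equivalent.
  Indeed, a 2-cochain whose coboundary preserves reducedness is determined, up to a scalar, by its
  values \<open>\<theta> (a, b)\<close> on \<open>S \<times> S\<close>, \<open>\<phi> a (a \<otimes> m)\<close> on \<open>S \<times> M\<close> and \<open>\<sigma> m\<close> at \<open>(inv m, m)\<close>, and its coboundary,
  written in terms of \<open>\<chi>\<close>, \<open>\<upsilon>\<close> and \<open>\<tau>\<close>, is the effect of the gauge transformation \<open>(\<theta>, \<phi>, \<sigma>)\<close>
  (\<open>twist_of_gauge\<close>, \<open>gauge_of_twist\<close>). So sending an ueberderivation to the class of its cocycle is
  a surjection onto the cohomology group whose fibres are the gauge equivalence classes.\<close>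

section \<open>Subgroups of index two\<close>

locale index_two_subgroup = group G for G (structure) +
  fixes S :: "'a set"
  assumes subgroup_S: "subgroup S G"
    and outside_nonempty: "carrier G - S \<noteq> {}"
    and outside_mult: "\<lbrakk>x \<in> carrier G - S; y \<in> carrier G - S\<rbrakk> \<Longrightarrow> x \<otimes> y \<in> S"
begin

text \<open>The nontrivial coset is kept as an opaque constant. The rules below then decide by rewriting
  alone in which of the two cosets a product lies, and \<open>m_assoc\<close>, \<open>inv_mult_group\<close> and the
  cancellation rules bring each product to the normal form of the free group.\<close>

definition M :: "'a set" where "M = carrier G - S"

lemma carrier_cases:
  assumes "x \<in> carrier G"
  obtains "x \<in> S" | "x \<in> M"
  using assms by (auto simp: M_def)

lemma S_carrier: "a \<in> S \<Longrightarrow> a \<in> carrier G"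
  using subgroup_S subgroup.mem_carrier by metis

lemma M_carrier: "m \<in> M \<Longrightarrow> m \<in> carrier G"
  by (simp add: M_def)

lemma M_not_S: "m \<in> M \<Longrightarrow> m \<notin> S"
  by (simp add: M_def)

lemma S_closed [simp]:
  "\<one> \<in> S" "a \<in> S \<Longrightarrow> inv a \<in> S" "\<lbrakk>a \<in> S; b \<in> S\<rbrakk> \<Longrightarrow> a \<otimes> b \<in> S"
  using subgroup_S by (auto intro: subgroup.one_closed subgroup.m_inv_closed subgroup.m_closed)

lemma cancel [simp]:
  assumes "x \<in> carrier G" "y \<in> carrier G"
  shows "x \<otimes> (inv x \<otimes> y) = y" "inv x \<otimes> (x \<otimes> y) = y"
  using assms by (simp_all add: m_assoc[symmetric])

declare m_assoc [simp] inv_mult_group [simp]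

lemma M_inv [simp]:
  assumes "m \<in> M"
  shows "inv m \<in> M"
proof -
  have "m \<in> carrier G" "m \<notin> S"
    using assms by (simp_all add: M_def)
  moreover from this have "inv m \<notin> S"
    using S_closed(2) inv_inv by metis
  ultimately show ?thesis by (simp add: M_def)
qed

lemma M_mult_left [simp]:
  assumes "a \<in> S" "m \<in> M"
  shows "a \<otimes> m \<in> M"
proof -
  have "inv a \<otimes> (a \<otimes> m) \<notin> S"
    using assms by (simp add: M_def S_carrier)
  then have "a \<otimes> m \<notin> S"
    using S_closed(2,3) assms(1) by blast
  with assms show ?thesis by (simp add: M_def S_carrier)
qed

lemma M_mult_right [simp]:
  assumes "m \<in> M" "a \<in> S"
  shows "m \<otimes> a \<in> M"
proof -
  have "m \<otimes> a \<otimes> inv a \<notin> S"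
    using assms by (simp add: M_def S_carrier)
  then have "m \<otimes> a \<notin> S"
    using S_closed(2,3) assms(2) by blast
  with assms show ?thesis by (simp add: M_def S_carrier)
qed

lemma M_mult [simp]: "\<lbrakk>m \<in> M; n \<in> M\<rbrakk> \<Longrightarrow> m \<otimes> n \<in> S"
  using outside_mult by (simp add: M_def)

definition base_point :: 'a where "base_point = (SOME m. m \<in> M)"

lemma base_point [simp]: "base_point \<in> M"
  unfolding base_point_def by (rule someI_ex) (use outside_nonempty in \<open>unfold M_def, blast\<close>)

end

lemma index_two_subgroupI:
  fixes G (structure)
  assumes "group G" and S: "subgroup S G" and index: "card (rcosets S) = 2"
  shows "index_two_subgroup G S"
proof -
  interpret group G by fact
  have coset_S: "S \<in> rcosets S"
    using S assms(1) by (rule subgroup.subgroup_in_rcosets)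
  obtain D E where "rcosets S = {D, E}" "D \<noteq> E"
    using index by (meson card_2_iff)
  moreover from this(1) coset_S have "S = D \<or> S = E"
    by simp
  ultimately obtain C where C: "C \<noteq> S" and cosets: "rcosets S = {S, C}"
    by (metis insert_commute)
  have other: "S #> x = C" if "x \<in> carrier G - S" for x
  proof -
    have "x \<in> S #> x"
      using that S by (intro rcos_self) simp_all
    moreover have "S #> x \<in> rcosets S"
      using that subgroup.subset[OF S] by (intro rcosetsI) simp_all
    ultimately show ?thesis
      using that unfolding cosets by blast
  qed
  show ?thesis
  proof (intro index_two_subgroup.intro index_two_subgroup_axioms.intro)
    show "group G" "subgroup S G" by fact+
    have "C \<in> rcosets S"
      unfolding cosets by simp
    then obtain x where "x \<in> carrier G" "C = S #> x"
      unfolding RCOSETS_def by blast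
    then show "carrier G - S \<noteq> {}"
      using C coset_join2[OF _ S, of x] by auto
    show "x \<otimes> y \<in> S" if x: "x \<in> carrier G - S" and y: "y \<in> carrier G - S" for x y
    proof -
      have "inv y \<in> carrier G - S"
        using y subgroup.m_inv_closed[OF S, of "inv y"] by auto
      then have "S #> inv y = S #> x"
        using other x by simp
      then have "x \<in> S #> inv y"
        using x S rcos_self by simp
      then obtain s where s: "s \<in> S" "x = s \<otimes> inv y"
        by (auto simp: r_coset_def)
      then have "x \<otimes> y = s"
        using y subgroup.mem_carrier[OF S s(1)] by (simp add: m_assoc)
      with s(1) show ?thesis by simp
    qed
  qed
qed

section \<open>The cocycle assembled from an ueberderivation\<close>

context index_two_subgroup
begin

text \<open>The cocycle condition of \<open>coboundary3\<close> without inverses, so that both sides are products.\<close>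

abbreviation cocycle_at :: "('a \<times> 'a \<times> 'a \<Rightarrow> 'f::field) \<Rightarrow> 'a \<Rightarrow> 'a \<Rightarrow> 'a \<Rightarrow> 'a \<Rightarrow> bool" where
  "cocycle_at w x y z t \<equiv>
     w (y, z, t) * w (x, y \<otimes> z, t) * w (x, y, z) = w (x \<otimes> y, z, t) * w (x, y, z \<otimes> t)"

definition cocycle :: "('a \<times> 'a \<times> 'a \<Rightarrow> 'f::field) \<Rightarrow> bool" where
  "cocycle w \<longleftrightarrow>
     (\<forall>x\<in>carrier G. \<forall>y\<in>carrier G. \<forall>z\<in>carrier G. w (x, y, z) \<noteq> 0) \<and>
     (\<forall>x\<in>carrier G. \<forall>y\<in>carrier G. \<forall>z\<in>carrier G. \<forall>t\<in>carrier G. cocycle_at w x y z t)"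

text \<open>A cocycle in the reduced form defined further below has no freedom left: its values are given
  by these formulas in terms of its values \<open>\<upsilon>\<close> at \<open>(a, b, m)\<close>, \<open>\<chi>\<close> at \<open>(a, m, b)\<close> and \<open>\<tau>\<close> at
  \<open>(inv m, m, inv m)\<close>, where \<open>a, b \<in> S\<close> and \<open>m \<in> M\<close>. The arguments of \<open>\<upsilon>\<close> and \<open>\<chi>\<close> in \<open>M\<close> are
  products of the three arguments of the cocycle; this shift is what turns the cocycle condition
  into the two-sided actions of \<open>S\<close>. On \<open>S\<close> alone the cocycle is the inverse of the coboundary of
  \<open>\<upsilon>\<close>, whose value does not depend on the point of \<open>M\<close> at which it is taken.\<close>

definition assemble ::
  "('a \<times> 'a \<Rightarrow> 'a \<Rightarrow> 'f) \<times> ('a \<times> 'a \<Rightarrow> 'a \<Rightarrow> 'f) \<times> ('a \<Rightarrow> 'f) \<Rightarrow> 'a \<times> 'a \<times> 'a \<Rightarrow> 'f::field" where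
  "assemble = (\<lambda>(\<chi>, \<upsilon>, \<tau>). \<lambda>(x, y, z) \<in> carrier G \<times> carrier G \<times> carrier G.
     if x \<in> S then
       if y \<in> S then
         if z \<in> S then
           (let p = base_point in
              \<upsilon> (x \<otimes> y, z) p * \<upsilon> (x, y) p / (\<upsilon> (y, z) (inv x \<otimes> p) * \<upsilon> (x, y \<otimes> z) p))
         else \<upsilon> (x, y) (x \<otimes> y \<otimes> z)
       else
         if z \<in> S then \<chi> (x, z) (x \<otimes> y \<otimes> z)
         else 1 / \<upsilon> (x, y \<otimes> z) (x \<otimes> y)
     else
       if y \<in> S then
         if z \<in> S then 1 / \<upsilon> (y, z) (inv x)
         else \<tau> x * \<chi> (y, x \<otimes> y \<otimes> z) (y \<otimes> z) / \<tau> (x \<otimes> y)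
       else
         if z \<in> S then \<upsilon> (x \<otimes> y, z) x
         else \<tau> y / \<chi> (x \<otimes> y, y \<otimes> z) (x \<otimes> y \<otimes> z))"

lemma assemble_extensional [simp]:
  "assemble u \<in> extensional (carrier G \<times> carrier G \<times> carrier G)"
  by (cases u) (simp add: assemble_def)

lemma assemble_simps [simp]:
  "\<lbrakk>a \<in> S; b \<in> S; m \<in> M\<rbrakk> \<Longrightarrow>
     assemble (\<chi>, \<upsilon>, \<tau>) (a, b, m) = \<upsilon> (a, b) (a \<otimes> b \<otimes> m)"
  "\<lbrakk>a \<in> S; m \<in> M; b \<in> S\<rbrakk> \<Longrightarrow>
     assemble (\<chi>, \<upsilon>, \<tau>) (a, m, b) = \<chi> (a, b) (a \<otimes> m \<otimes> b)"
  "\<lbrakk>a \<in> S; m \<in> M; n \<in> M\<rbrakk> \<Longrightarrow>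
     assemble (\<chi>, \<upsilon>, \<tau>) (a, m, n) = 1 / \<upsilon> (a, m \<otimes> n) (a \<otimes> m)"
  "\<lbrakk>m \<in> M; a \<in> S; b \<in> S\<rbrakk> \<Longrightarrow>
     assemble (\<chi>, \<upsilon>, \<tau>) (m, a, b) = 1 / \<upsilon> (a, b) (inv m)"
  "\<lbrakk>m \<in> M; a \<in> S; n \<in> M\<rbrakk> \<Longrightarrow>
     assemble (\<chi>, \<upsilon>, \<tau>) (m, a, n) = \<tau> m * \<chi> (a, m \<otimes> a \<otimes> n) (a \<otimes> n) / \<tau> (m \<otimes> a)"
  "\<lbrakk>m \<in> M; n \<in> M; a \<in> S\<rbrakk> \<Longrightarrow>
     assemble (\<chi>, \<upsilon>, \<tau>) (m, n, a) = \<upsilon> (m \<otimes> n, a) m"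
  "\<lbrakk>m \<in> M; n \<in> M; p \<in> M\<rbrakk> \<Longrightarrow>
     assemble (\<chi>, \<upsilon>, \<tau>) (m, n, p) = \<tau> n / \<chi> (m \<otimes> n, n \<otimes> p) (m \<otimes> n \<otimes> p)"
  by (simp_all add: assemble_def S_carrier M_carrier M_not_S)

end

text \<open>The equations of an ueberderivation at single points of \<open>M\<close>, each solved for one value so that
  it can serve as a rewrite rule. As \<open>S\<close> acts freely on \<open>M\<close>, only \<open>\<one>\<close> acts trivially, so
  that the conditions on the trivially acting elements amount to \<open>tau_inv\<close>.\<close>

locale pointwise_ueberderivation = index_two_subgroup +
  fixes \<chi> \<upsilon> :: "'a \<times> 'a \<Rightarrow> 'a \<Rightarrow> 'f::field" and \<tau> :: "'a \<Rightarrow> 'f"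
  assumes chi_nonzero [simp]: "\<lbrakk>a \<in> S; b \<in> S; m \<in> M\<rbrakk> \<Longrightarrow> \<chi> (a, b) m \<noteq> 0"
    and upsilon_nonzero [simp]: "\<lbrakk>a \<in> S; b \<in> S; m \<in> M\<rbrakk> \<Longrightarrow> \<upsilon> (a, b) m \<noteq> 0"
    and tau_nonzero [simp]: "m \<in> M \<Longrightarrow> \<tau> m \<noteq> 0"
    and upsilon_one: "\<lbrakk>a \<in> S; m \<in> M\<rbrakk> \<Longrightarrow> \<upsilon> (\<one>, a) m = 1"
                     "\<lbrakk>a \<in> S; m \<in> M\<rbrakk> \<Longrightarrow> \<upsilon> (a, \<one>) m = 1"
    and chi_swap: "\<lbrakk>a \<in> S; b \<in> S; m \<in> M\<rbrakk> \<Longrightarrow>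
      \<chi> (b, a) (inv m) = \<chi> (a, b) (a \<otimes> m \<otimes> b) *
        (\<tau> (a \<otimes> m \<otimes> b) * \<tau> m) / (\<tau> (a \<otimes> m) * \<tau> (m \<otimes> b))"
    and chi_mult_left: "\<lbrakk>a \<in> S; b \<in> S; c \<in> S; m \<in> M\<rbrakk> \<Longrightarrow>
      \<chi> (a \<otimes> b, c) m =
        \<chi> (a, c) m * \<chi> (b, c) (inv a \<otimes> m) * \<upsilon> (a, b) (m \<otimes> inv c) / \<upsilon> (a, b) m"
    and tau_inv: "m \<in> M \<Longrightarrow> \<tau> (inv m) = 1 / \<tau> m"
begin

lemma chi_swap_inner:
  assumes "a \<in> S" "b \<in> S" "m \<in> M"
  shows "\<chi> (a, b) (a \<otimes> m \<otimes> b) =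
    \<chi> (b, a) (inv m) * (\<tau> (a \<otimes> m) * \<tau> (m \<otimes> b)) / (\<tau> (a \<otimes> m \<otimes> b) * \<tau> m)"
proof -
  note carrier [simp] = assms(1,2)[THEN S_carrier] assms(3)[THEN M_carrier]
  have nz: "\<tau> (a \<otimes> m) \<noteq> 0" "\<tau> (m \<otimes> b) \<noteq> 0" "\<tau> (a \<otimes> m \<otimes> b) \<noteq> 0" "\<tau> m \<noteq> 0"
    using assms by simp_all
  show ?thesis
    unfolding chi_swap[OF assms] using nz by (simp del: m_assoc)
qed

text \<open>Multiplicativity in the second argument is multiplicativity in the first, transported by
  exchanging the arguments: in the three exchanges all factors \<open>\<tau>\<close> cancel.\<close>

lemma chi_mult_right:
  assumes "a \<in> S" "b \<in> S" "c \<in> S" "m \<in> M"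
  shows "\<chi> (a, b \<otimes> c) (a \<otimes> m \<otimes> b \<otimes> c) =
    \<chi> (a, c) (a \<otimes> m \<otimes> b \<otimes> c) * \<chi> (a, b) (a \<otimes> m \<otimes> b) *
      \<upsilon> (b, c) (inv m \<otimes> inv a) / \<upsilon> (b, c) (inv m)"
proof -
  note carrier [simp] = assms(1-3)[THEN S_carrier] assms(4)[THEN M_carrier]
  have "\<chi> (a, b \<otimes> c) (a \<otimes> m \<otimes> b \<otimes> c) =
      \<chi> (b \<otimes> c, a) (inv m) *
      (\<tau> (a \<otimes> m) * \<tau> (m \<otimes> b \<otimes> c)) / (\<tau> (a \<otimes> m \<otimes> b \<otimes> c) * \<tau> m)"
    using chi_swap_inner[of a "b \<otimes> c" m] assms by simp
  moreover have "\<chi> (a, c) (a \<otimes> m \<otimes> b \<otimes> c) =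
      \<chi> (c, a) (inv b \<otimes> inv m) *
      (\<tau> (a \<otimes> m \<otimes> b) * \<tau> (m \<otimes> b \<otimes> c)) / (\<tau> (a \<otimes> m \<otimes> b \<otimes> c) * \<tau> (m \<otimes> b))"
    using chi_swap_inner[of a c "m \<otimes> b"] assms by simp
  ultimately show ?thesis
    using assms
    by (simp add: chi_mult_left[of b c a "inv m"] chi_swap_inner[of a b m, simplified] mult_ac)
qed

text \<open>The inverse of the coboundary of \<open>\<upsilon>\<close> with respect to the left action of \<open>S\<close>, at the point \<open>p\<close>.
  Right translation by \<open>d\<close> multiplies \<open>\<upsilon>\<close> by a coboundary of \<open>\<chi> (_, d)\<close>, by \<open>chi_mult_left\<close>, hence
  does not change it. As the right action of \<open>S\<close> on \<open>M\<close> is transitive, it is constant in \<open>p\<close>.\<close>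

abbreviation defect where
  "defect a b c p \<equiv> \<upsilon> (a \<otimes> b, c) p * \<upsilon> (a, b) p / (\<upsilon> (b, c) (inv a \<otimes> p) * \<upsilon> (a, b \<otimes> c) p)"

lemma upsilon_translate:
  assumes "a \<in> S" "b \<in> S" "c \<in> S" "m \<in> M"
  shows "\<upsilon> (a, b) (m \<otimes> inv c) =
    \<upsilon> (a, b) m * \<chi> (a \<otimes> b, c) m / (\<chi> (a, c) m * \<chi> (b, c) (inv a \<otimes> m))"
  using assms by (simp add: chi_mult_left[of a b c m])

lemma defect_translate:
  assumes "a \<in> S" "b \<in> S" "c \<in> S" "d \<in> S" "p \<in> M"
  shows "defect a b c (p \<otimes> inv d) = defect a b c p"
proof -
  note carrier [simp] = assms(1-4)[THEN S_carrier] assms(5)[THEN M_carrier]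
  have "\<upsilon> (b, c) (inv a \<otimes> (p \<otimes> inv d)) = \<upsilon> (b, c) (inv a \<otimes> p) * \<chi> (b \<otimes> c, d) (inv a \<otimes> p) /
      (\<chi> (b, d) (inv a \<otimes> p) * \<chi> (c, d) (inv b \<otimes> (inv a \<otimes> p)))"
    using assms upsilon_translate[of b c d "inv a \<otimes> p"] by simp
  with assms show ?thesis
    by (simp add: upsilon_translate)
qed

lemma assemble_SSS:
  assumes "a \<in> S" "b \<in> S" "c \<in> S" "p \<in> M"
  shows "assemble (\<chi>, \<upsilon>, \<tau>) (a, b, c) = defect a b c p"
proof -
  have [simp]: "p \<in> carrier G" "base_point \<in> carrier G"
    using assms by (simp_all add: M_carrier)
  have "defect a b c (p \<otimes> inv (inv base_point \<otimes> p)) = defect a b c p"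
    using assms by (intro defect_translate) simp_all
  with assms show ?thesis
    by (simp add: assemble_def S_carrier)
qed

lemma assemble_nonzero:
  assumes "x \<in> carrier G" "y \<in> carrier G" "z \<in> carrier G"
  shows "assemble (\<chi>, \<upsilon>, \<tau>) (x, y, z) \<noteq> 0"
  using assms by (elim carrier_cases) (simp_all add: assemble_SSS[of _ _ _ base_point])

text \<open>The cocycle condition for \<open>assemble (\<chi>, \<upsilon>, \<tau>)\<close> splits into 16 cases, according to the cosets
  of the four arguments; these are the letters in the names of the lemmas. Five kinds of reasons
  occur. On \<open>S\<close> the cocycle is the inverse of a coboundary with values in the functions on \<open>M\<close>, and
  the identity is a cancellation once this is evaluated at suitably translated points. In the
  cases \<open>SSSM\<close>, \<open>MSSS\<close>, \<open>SSMM\<close>, \<open>SMMS\<close>, \<open>MMSS\<close> the condition is the independence of the point \<open>p\<close>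
  in \<open>defect\<close>; in \<open>SSMS\<close>, \<open>MSSM\<close>, \<open>SMMM\<close>, \<open>MMSM\<close> it is \<open>chi_mult_left\<close>; in \<open>SMSS\<close>, \<open>MSMS\<close>,
  \<open>MMMS\<close> it is \<open>chi_mult_right\<close>; in \<open>SMSM\<close>, \<open>MSMM\<close>, \<open>MMMM\<close> it is \<open>chi_mult_right\<close> together with
  the exchange \<open>chi_swap\<close>, which absorbs the factors \<open>\<tau>\<close>. The instances are read off by matching the
  values of \<open>\<chi>\<close>.\<close>

lemma cocycle_SSSS:
  assumes "x \<in> S" "y \<in> S" "z \<in> S" "t \<in> S"
  shows "cocycle_at (assemble (\<chi>, \<upsilon>, \<tau>)) x y z t"
proof -
  note [simp] = assms assms(1,2,3,4)[THEN S_carrier] M_carrier[OF base_point]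
  show ?thesis
    by (simp add:
      assemble_SSS[of y z t "inv x \<otimes> base_point", simplified]
      assemble_SSS[of x "y \<otimes> z" t base_point, simplified]
      assemble_SSS[of x y z base_point, simplified]
      assemble_SSS[of "x \<otimes> y" z t base_point, simplified]
      assemble_SSS[of x y "z \<otimes> t" base_point, simplified]
      field_simps)
qed

lemma cocycle_SSSM:
  assumes "x \<in> S" "y \<in> S" "z \<in> S" "t \<in> M"
  shows "cocycle_at (assemble (\<chi>, \<upsilon>, \<tau>)) x y z t"
proof -
  note [simp] = assms assms(1,2,3)[THEN S_carrier] assms(4)[THEN M_carrier]
  show ?thesis
    by (simp add:
      assemble_SSS[of x y z "x \<otimes> y \<otimes> z \<otimes> t", simplified]
      field_simps)
qed

lemma cocycle_SSMS:
  assumes "x \<in> S" "y \<in> S" "z \<in> M" "t \<in> S"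
  shows "cocycle_at (assemble (\<chi>, \<upsilon>, \<tau>)) x y z t"
proof -
  note [simp] = assms assms(1,2,4)[THEN S_carrier] assms(3)[THEN M_carrier]
  show ?thesis
    by (simp add:
      chi_mult_left[of x y t "x \<otimes> y \<otimes> z \<otimes> t", simplified]
      field_simps)
qed

lemma cocycle_SMSS:
  assumes "x \<in> S" "y \<in> M" "z \<in> S" "t \<in> S"
  shows "cocycle_at (assemble (\<chi>, \<upsilon>, \<tau>)) x y z t"
proof -
  note [simp] = assms assms(1,3,4)[THEN S_carrier] assms(2)[THEN M_carrier]
  show ?thesis
    by (simp add:
      chi_mult_right[of x z t y, simplified]
      field_simps)
qed

lemma cocycle_MSSS:
  assumes "x \<in> M" "y \<in> S" "z \<in> S" "t \<in> S"
  shows "cocycle_at (assemble (\<chi>, \<upsilon>, \<tau>)) x y z t"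
proof -
  note [simp] = assms assms(2,3,4)[THEN S_carrier] assms(1)[THEN M_carrier]
  show ?thesis
    by (simp add:
      assemble_SSS[of y z t "inv x", simplified]
      field_simps)
qed

lemma cocycle_SSMM:
  assumes "x \<in> S" "y \<in> S" "z \<in> M" "t \<in> M"
  shows "cocycle_at (assemble (\<chi>, \<upsilon>, \<tau>)) x y z t"
proof -
  note [simp] = assms assms(1,2)[THEN S_carrier] assms(3,4)[THEN M_carrier]
  show ?thesis
    by (simp add:
      assemble_SSS[of x y "z \<otimes> t" "x \<otimes> y \<otimes> z", simplified]
      field_simps)
qed

lemma cocycle_SMSM:
  assumes "x \<in> S" "y \<in> M" "z \<in> S" "t \<in> M"
  shows "cocycle_at (assemble (\<chi>, \<upsilon>, \<tau>)) x y z t"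
proof -
  note [simp] = assms assms(1,3)[THEN S_carrier] assms(2,4)[THEN M_carrier]
  show ?thesis
    by (simp add:
      chi_mult_right[of z x "y \<otimes> z \<otimes> t" "inv z \<otimes> inv y \<otimes> inv x", simplified]
      chi_swap[of x z y, simplified]
      field_simps)
qed

lemma cocycle_SMMS:
  assumes "x \<in> S" "y \<in> M" "z \<in> M" "t \<in> S"
  shows "cocycle_at (assemble (\<chi>, \<upsilon>, \<tau>)) x y z t"
proof -
  note [simp] = assms assms(1,4)[THEN S_carrier] assms(2,3)[THEN M_carrier]
  show ?thesis
    by (simp add:
      assemble_SSS[of x "y \<otimes> z" t "x \<otimes> y", simplified]
      field_simps)
qed

lemma cocycle_MSSM:
  assumes "x \<in> M" "y \<in> S" "z \<in> S" "t \<in> M"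
  shows "cocycle_at (assemble (\<chi>, \<upsilon>, \<tau>)) x y z t"
proof -
  note [simp] = assms assms(2,3)[THEN S_carrier] assms(1,4)[THEN M_carrier]
  show ?thesis
    by (simp add:
      chi_mult_left[of y z "x \<otimes> y \<otimes> z \<otimes> t" "y \<otimes> z \<otimes> t", simplified]
      field_simps)
qed

lemma cocycle_MSMS:
  assumes "x \<in> M" "y \<in> S" "z \<in> M" "t \<in> S"
  shows "cocycle_at (assemble (\<chi>, \<upsilon>, \<tau>)) x y z t"
proof -
  note [simp] = assms assms(2,4)[THEN S_carrier] assms(1,3)[THEN M_carrier]
  show ?thesis
    by (simp add:
      chi_mult_right[of y "x \<otimes> y \<otimes> z" t "inv y \<otimes> inv x", simplified]
      field_simps)
qed

lemma cocycle_MMSS: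
  assumes "x \<in> M" "y \<in> M" "z \<in> S" "t \<in> S"
  shows "cocycle_at (assemble (\<chi>, \<upsilon>, \<tau>)) x y z t"
proof -
  note [simp] = assms assms(3,4)[THEN S_carrier] assms(1,2)[THEN M_carrier]
  show ?thesis
    by (simp add:
      assemble_SSS[of "x \<otimes> y" z t x, simplified]
      field_simps)
qed

lemma cocycle_SMMM:
  assumes "x \<in> S" "y \<in> M" "z \<in> M" "t \<in> M"
  shows "cocycle_at (assemble (\<chi>, \<upsilon>, \<tau>)) x y z t"
proof -
  note [simp] = assms assms(1)[THEN S_carrier] assms(2,3,4)[THEN M_carrier]
  show ?thesis
    by (simp add:
      chi_mult_left[of x "y \<otimes> z" "z \<otimes> t" "x \<otimes> y \<otimes> z \<otimes> t", simplified]
      field_simps)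
qed

lemma cocycle_MSMM:
  assumes "x \<in> M" "y \<in> S" "z \<in> M" "t \<in> M"
  shows "cocycle_at (assemble (\<chi>, \<upsilon>, \<tau>)) x y z t"
proof -
  note [simp] = assms assms(2)[THEN S_carrier] assms(1,3,4)[THEN M_carrier]
  show ?thesis
    by (simp add:
      chi_mult_right[of "x \<otimes> y \<otimes> z" y "z \<otimes> t" "inv z \<otimes> inv y", simplified]
      chi_swap[of y "x \<otimes> y \<otimes> z" "inv y \<otimes> inv x", simplified]
      tau_inv[of "x \<otimes> y", simplified]
      tau_inv[of x, simplified]
      field_simps)
qed

lemma cocycle_MMSM:
  assumes "x \<in> M" "y \<in> M" "z \<in> S" "t \<in> M"
  shows "cocycle_at (assemble (\<chi>, \<upsilon>, \<tau>)) x y z t"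
proof -
  note [simp] = assms assms(3)[THEN S_carrier] assms(1,2,4)[THEN M_carrier]
  show ?thesis
    by (simp add:
      chi_mult_left[of "x \<otimes> y" z "y \<otimes> z \<otimes> t" "x \<otimes> y \<otimes> z \<otimes> t", simplified]
      field_simps)
qed

lemma cocycle_MMMS:
  assumes "x \<in> M" "y \<in> M" "z \<in> M" "t \<in> S"
  shows "cocycle_at (assemble (\<chi>, \<upsilon>, \<tau>)) x y z t"
proof -
  note [simp] = assms assms(4)[THEN S_carrier] assms(1,2,3)[THEN M_carrier]
  show ?thesis
    by (simp add:
      chi_mult_right[of "x \<otimes> y" "y \<otimes> z" t "inv y", simplified]
      field_simps)
qed

lemma cocycle_MMMM:
  assumes "x \<in> M" "y \<in> M" "z \<in> M" "t \<in> M"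
  shows "cocycle_at (assemble (\<chi>, \<upsilon>, \<tau>)) x y z t"
proof -
  note [simp] = assms assms(1,2,3,4)[THEN M_carrier]
  show ?thesis
    by (simp add:
      chi_mult_right[of "y \<otimes> z" "x \<otimes> y" "z \<otimes> t" "inv z \<otimes> inv y \<otimes> inv x", simplified]
      chi_swap[of "x \<otimes> y" "y \<otimes> z" "inv y", simplified]
      tau_inv[of y, simplified]
      field_simps)
qed

lemma cocycle_assemble: "cocycle (assemble (\<chi>, \<upsilon>, \<tau>))"
proof -
  have "cocycle_at (assemble (\<chi>, \<upsilon>, \<tau>)) x y z t"
    if "x \<in> carrier G" "y \<in> carrier G" "z \<in> carrier G" "t \<in> carrier G" for x y z t
    using that
    by (elim carrier_cases) (fact cocycle_SSSS cocycle_SSSM cocycle_SSMS cocycle_SMSS cocycle_MSSS cocycle_SSMM cocycle_SMSM cocycle_SMMS cocycle_MSSM cocycle_MSMS cocycle_MMSS cocycle_SMMM cocycle_MSMM cocycle_MMSM cocycle_MMMS cocycle_MMMM)+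
  then show ?thesis
    by (simp add: cocycle_def assemble_nonzero)
qed

end

section \<open>Reduction of cocycles\<close>

context index_two_subgroup
begin

definition unit_cochain :: "('a \<times> 'a \<Rightarrow> 'f::field) \<Rightarrow> bool" where
  "unit_cochain f \<longleftrightarrow> (\<forall>x\<in>carrier G. \<forall>y\<in>carrier G. f (x, y) \<noteq> 0)"

text \<open>Multiplication of a 3-cochain by the coboundary of the 2-cochain \<open>f\<close>.\<close>

definition twist :: "('a \<times> 'a \<Rightarrow> 'f::field) \<Rightarrow> ('a \<times> 'a \<times> 'a \<Rightarrow> 'f) \<Rightarrow> 'a \<times> 'a \<times> 'a \<Rightarrow> 'f" where
  "twist f w = (\<lambda>(x, y, z) \<in> carrier G \<times> carrier G \<times> carrier G.
     w (x, y, z) * (f (y, z) * f (x, y \<otimes> z) / (f (x \<otimes> y, z) * f (x, y))))"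

lemma twist_apply [simp]:
  "\<lbrakk>x \<in> carrier G; y \<in> carrier G; z \<in> carrier G\<rbrakk> \<Longrightarrow>
     twist f w (x, y, z) = w (x, y, z) * (f (y, z) * f (x, y \<otimes> z) / (f (x \<otimes> y, z) * f (x, y)))"
  by (simp add: twist_def)

lemma twist_extensional [simp]: "twist f w \<in> extensional (carrier G \<times> carrier G \<times> carrier G)"
  by (simp add: twist_def)

lemma cochain_eqI:
  assumes "v \<in> extensional (carrier G \<times> carrier G \<times> carrier G)"
    and "w \<in> extensional (carrier G \<times> carrier G \<times> carrier G)"
    and "\<And>x y z. \<lbrakk>x \<in> carrier G; y \<in> carrier G; z \<in> carrier G\<rbrakk> \<Longrightarrow> v (x, y, z) = w (x, y, z)"
  shows "v = w"
  using assms by (intro extensionalityI[of v "carrier G \<times> carrier G \<times> carrier G" w]) auto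

lemma unit_cochain_nonzero:
  "\<lbrakk>unit_cochain f; x \<in> carrier G; y \<in> carrier G\<rbrakk> \<Longrightarrow> f (x, y) \<noteq> 0"
  by (simp add: unit_cochain_def)

lemma cocycle_nonzero:
  "\<lbrakk>cocycle w; x \<in> carrier G; y \<in> carrier G; z \<in> carrier G\<rbrakk> \<Longrightarrow> w (x, y, z) \<noteq> 0"
  by (simp add: cocycle_def)

lemma cocycleD:
  "\<lbrakk>cocycle w; x \<in> carrier G; y \<in> carrier G; z \<in> carrier G; t \<in> carrier G\<rbrakk> \<Longrightarrow> cocycle_at w x y z t"
  by (simp add: cocycle_def)

lemma cocycle_twist:
  assumes w: "cocycle w" and f: "unit_cochain f"
  shows "cocycle (twist f w)"
  unfolding cocycle_def
proof (intro conjI ballI)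
  note nz [simp] = cocycle_nonzero[OF w] unit_cochain_nonzero[OF f]
  show "twist f w (x, y, z) \<noteq> 0"
    if "x \<in> carrier G" "y \<in> carrier G" "z \<in> carrier G" for x y z
    using that by simp
  show "cocycle_at (twist f w) x y z t"
    if [simp]: "x \<in> carrier G" "y \<in> carrier G" "z \<in> carrier G" "t \<in> carrier G" for x y z t
  proof -
    have "w (y, z, t) = w (x \<otimes> y, z, t) * w (x, y, z \<otimes> t) / (w (x, y \<otimes> z, t) * w (x, y, z))"
      using cocycleD[OF w, of x y z t] by (simp add: field_simps)
    then show ?thesis by (simp add: field_simps)
  qed
qed

lemma twist_twist:
  assumes "unit_cochain f" "unit_cochain g"
  shows "twist g (twist f w) = twist (\<lambda>p. f p * g p) w"
  by (rule cochain_eqI) (simp_all add: mult_ac)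

lemma twist_one:
  assumes "w \<in> extensional (carrier G \<times> carrier G \<times> carrier G)"
  shows "twist (\<lambda>_. 1) w = w"
  using assms by (intro cochain_eqI) simp_all

text \<open>Twisting by a normalized 2-cochain \<open>f\<close> is used up in two ways. The values of \<open>f\<close> on \<open>M \<times> M\<close>
  other than those at \<open>(inv m, m)\<close> are spent on making the cocycle trivial at \<open>(a, inv m, m)\<close>, the
  values on \<open>M \<times> S\<close> on making it trivial at \<open>(inv m, m, a)\<close>. The values left are those on \<open>S \<times> S\<close>, on \<open>S \<times> M\<close> and at \<open>(inv m, m)\<close>,
  which are the three components \<open>\<theta>\<close>, \<open>\<phi>\<close>, \<open>\<sigma>\<close> of a gauge transformation.\<close>

definition reduced :: "('a \<times> 'a \<times> 'a \<Rightarrow> 'f::field) \<Rightarrow> bool" where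
  "reduced w \<longleftrightarrow> cocycle w \<and> w \<in> extensional (carrier G \<times> carrier G \<times> carrier G) \<and>
     (\<forall>x\<in>carrier G. \<forall>y\<in>carrier G. w (\<one>, x, y) = 1 \<and> w (x, \<one>, y) = 1 \<and> w (x, y, \<one>) = 1) \<and>
     (\<forall>a\<in>S. \<forall>m\<in>M. w (a, inv m, m) = 1 \<and> w (inv m, m, a) = 1)"

lemma normalized_outer:
  assumes w: "cocycle w"
    and mid: "\<And>x y. \<lbrakk>x \<in> carrier G; y \<in> carrier G\<rbrakk> \<Longrightarrow> w (x, \<one>, y) = 1"
    and [simp]: "x \<in> carrier G" "y \<in> carrier G"
  shows "w (\<one>, x, y) = 1" "w (x, y, \<one>) = 1"
proof -
  note nz [simp] = cocycle_nonzero[OF w]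
  show "w (\<one>, x, y) = 1"
    using cocycleD[OF w, of \<one> \<one> x y] by (simp add: mid)
  show "w (x, y, \<one>) = 1"
    using cocycleD[OF w, of x y \<one> \<one>] by (simp add: mid)
qed

lemma normalize_cocycle:
  assumes w: "cocycle w"
  obtains f where "unit_cochain f"
    "\<And>x y. \<lbrakk>x \<in> carrier G; y \<in> carrier G\<rbrakk> \<Longrightarrow> twist f w (x, \<one>, y) = 1"
proof
  note nz [simp] = cocycle_nonzero[OF w]
  \<comment> \<open>The cocycle condition at \<open>(x, \<one>, \<one>, y)\<close> splits \<open>w (x, \<one>, y)\<close> into a factor depending on \<open>x\<close>
    and one depending on \<open>y\<close>; at \<open>(\<one>, \<one>)\<close> both prescriptions give 1.\<close>
  define f where "f = (\<lambda>(x, y). if x = \<one> then 1 / w (\<one>, \<one>, y) else if y = \<one> then w (x, \<one>, \<one>) else 1)"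
  show "unit_cochain f"
    by (simp add: unit_cochain_def f_def)
  have one: "w (\<one>, \<one>, \<one>) = 1"
    using cocycleD[OF w, of \<one> \<one> \<one> \<one>] by simp
  show "twist f w (x, \<one>, y) = 1" if [simp]: "x \<in> carrier G" "y \<in> carrier G" for x y
  proof -
    have "w (x, \<one>, y) = w (\<one>, \<one>, y) * w (x, \<one>, \<one>)"
      using cocycleD[OF w, of x \<one> \<one> y] by simp
    moreover have "f (x, y) \<noteq> 0"
      by (simp add: f_def)
    ultimately show ?thesis
      by (simp add: f_def one)
  qed
qed

lemma reduce_normalized:
  assumes w: "cocycle w"
    and mid: "\<And>x y. \<lbrakk>x \<in> carrier G; y \<in> carrier G\<rbrakk> \<Longrightarrow> w (x, \<one>, y) = 1"
  obtains f where "unit_cochain f" "reduced (twist f w)"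
proof
  note nz [simp] = cocycle_nonzero[OF w]
  note one [simp] = mid normalized_outer[OF w mid]
  \<comment> \<open>The two conditions of a reduced cocycle, solved for \<open>f\<close> after setting it to 1 on \<open>S \<times> G\<close> and
    at all \<open>(inv m, m)\<close>.\<close>
  define f where "f = (\<lambda>(x, y).
    if x \<in> S then 1
    else if y \<in> S then 1 / (w (inv x, x, y) * w (y, inv y \<otimes> inv x, x \<otimes> y))
    else w (x \<otimes> y, inv y, y))"
  have f_S: "f (a, x) = 1" if "a \<in> S" for a x
    using that by (simp add: f_def)
  have f_MS: "f (m, a) = 1 / (w (inv m, m, a) * w (a, inv a \<otimes> inv m, m \<otimes> a))"
    if "m \<in> M" "a \<in> S" for m a
    using that by (simp add: f_def M_not_S)
  have f_MM: "f (m, n) = w (m \<otimes> n, inv n, n)" if "m \<in> M" "n \<in> M" for m n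
    using that by (simp add: f_def M_not_S)
  note [simp] = S_carrier M_carrier
  show f: "unit_cochain f"
    unfolding unit_cochain_def
    by (auto elim!: carrier_cases simp: f_S f_MS f_MM)
  have f_one: "f (x, \<one>) = 1" if "x \<in> carrier G" for x
    using that by (elim carrier_cases) (simp_all add: f_S f_MS)
  have "twist f w (x, \<one>, y) = 1" if "x \<in> carrier G" "y \<in> carrier G" for x y
    using that unit_cochain_nonzero[OF f] by (simp add: f_one f_S)
  note one' = this normalized_outer[OF cocycle_twist[OF w f] this]
  have "twist f w (a, inv m, m) = 1" if "a \<in> S" "m \<in> M" for a m
    using that by (simp add: f_S f_MM)
  moreover have "twist f w (inv m, m, a) = 1" if "a \<in> S" "m \<in> M" for a m
    using that by (simp add: f_S f_MS f_MM)
  ultimately show "reduced (twist f w)"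
    using one' cocycle_twist[OF w f] by (simp add: reduced_def)
qed

lemma exists_reduced:
  assumes w: "cocycle w"
  obtains f where "unit_cochain f" "reduced (twist f w)"
proof -
  obtain f where f: "unit_cochain f"
    and mid: "\<And>x y. \<lbrakk>x \<in> carrier G; y \<in> carrier G\<rbrakk> \<Longrightarrow> twist f w (x, \<one>, y) = 1"
    using normalize_cocycle[OF w] by blast
  obtain g where g: "unit_cochain g" "reduced (twist g (twist f w))"
    using reduce_normalized[OF cocycle_twist[OF w f] mid] by blast
  show thesis
  proof (rule that)
    show "unit_cochain (\<lambda>p. f p * g p)"
      using f g(1) by (simp add: unit_cochain_def)
    show "reduced (twist (\<lambda>p. f p * g p) w)"
      using g twist_twist[OF f g(1), of w] by simp
  qed
qed

text \<open>The inverse of \<open>assemble\<close> on reduced cocycles.\<close>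

definition components ::
  "('a \<times> 'a \<times> 'a \<Rightarrow> 'f::field) \<Rightarrow>
     ('a \<times> 'a \<Rightarrow> 'a \<Rightarrow> 'f) \<times> ('a \<times> 'a \<Rightarrow> 'a \<Rightarrow> 'f) \<times> ('a \<Rightarrow> 'f)" where
  "components w =
     (\<lambda>(a, b) \<in> S \<times> S. \<lambda>m \<in> M. w (a, inv a \<otimes> m \<otimes> inv b, b),
      \<lambda>(a, b) \<in> S \<times> S. \<lambda>m \<in> M. w (a, b, inv b \<otimes> inv a \<otimes> m),
      \<lambda>m \<in> M. w (inv m, m, inv m))"

end

locale reduced_cocycle = index_two_subgroup +
  fixes w :: "'a \<times> 'a \<times> 'a \<Rightarrow> 'f::field"
  assumes reduced: "reduced w"
begin

lemma nonzero [simp]: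
  "\<lbrakk>x \<in> carrier G; y \<in> carrier G; z \<in> carrier G\<rbrakk> \<Longrightarrow> w (x, y, z) \<noteq> 0"
  using reduced by (auto simp: reduced_def cocycle_def)

lemma cocycle_eq:
  "\<lbrakk>x \<in> carrier G; y \<in> carrier G; z \<in> carrier G; t \<in> carrier G\<rbrakk> \<Longrightarrow> cocycle_at w x y z t"
  using reduced by (simp add: reduced_def cocycle_def)

lemma one [simp]:
  assumes "x \<in> carrier G" "y \<in> carrier G"
  shows "w (\<one>, x, y) = 1" "w (x, \<one>, y) = 1" "w (x, y, \<one>) = 1"
  using reduced assms by (simp_all add: reduced_def)

lemma S_inv_M [simp]: "\<lbrakk>a \<in> S; m \<in> M\<rbrakk> \<Longrightarrow> w (a, inv m, m) = 1"
  and inv_M_S [simp]: "\<lbrakk>m \<in> M; a \<in> S\<rbrakk> \<Longrightarrow> w (inv m, m, a) = 1"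
  using reduced by (simp_all add: reduced_def)

lemma S_M_inv [simp]: "\<lbrakk>a \<in> S; m \<in> M\<rbrakk> \<Longrightarrow> w (a, m, inv m) = 1"
  and M_inv_S [simp]: "\<lbrakk>m \<in> M; a \<in> S\<rbrakk> \<Longrightarrow> w (m, inv m, a) = 1"
  using S_inv_M[of a "inv m"] inv_M_S[of "inv m" a] by (simp_all add: M_carrier)

abbreviation tau where "tau m \<equiv> w (inv m, m, inv m)"

text \<open>The following lemmas express the values of a reduced cocycle on the remaining types of triples
  by the three components. Except for \<open>SSS\<close>, where an element of \<open>M\<close> is appended, each comes from
  the cocycle condition at four arguments among which some \<open>n \<in> M\<close> stands next to its inverse, so
  that most factors are 1 or known from the lemmas before.\<close>

lemma SMM:
  assumes "a \<in> S" "m \<in> M" "n \<in> M"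
  shows "w (a, m, n) = 1 / w (a, m \<otimes> n, inv n)"
proof -
  note [simp] = assms assms(1)[THEN S_carrier] assms(2-)[THEN M_carrier]
  show ?thesis
    using cocycle_eq[of a "m \<otimes> n" "inv n" n] by (simp add: field_simps)
qed

lemma MMS:
  assumes "m \<in> M" "n \<in> M" "b \<in> S"
  shows "w (m, n, b) = w (m \<otimes> n, b, inv b \<otimes> inv n)"
proof -
  note [simp] = assms assms(3)[THEN S_carrier] assms(1-2)[THEN M_carrier]
  show ?thesis
    using cocycle_eq[of "m \<otimes> n" "inv n" n b] SMM[of "m \<otimes> n" "inv n" "n \<otimes> b"]
    by (simp add: field_simps)
qed

lemma MSS:
  assumes "m \<in> M" "a \<in> S" "b \<in> S"
  shows "w (m, a, b) = 1 / w (a, b, inv b \<otimes> (inv a \<otimes> inv m))"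
proof -
  note [simp] = assms assms(2-3)[THEN S_carrier] assms(1)[THEN M_carrier]
  show ?thesis
    using cocycle_eq[of "inv m" m a b] MMS[of "inv m" "m \<otimes> a" b] by (simp add: field_simps)
qed

lemma inv_M_M:
  assumes "m \<in> M" "n \<in> M"
  shows "w (inv m, m, n) = tau m"
proof -
  note [simp] = assms assms[THEN M_carrier]
  show ?thesis
    using cocycle_eq[of "inv m" m "inv m" "m \<otimes> n"] by simp
qed

lemma MMM:
  assumes "m \<in> M" "n \<in> M" "p \<in> M"
  shows "w (m, n, p) = tau n / w (m \<otimes> n, inv n, n \<otimes> p)"
proof -
  note [simp] = assms assms[THEN M_carrier]
  show ?thesis
    using cocycle_eq[of "m \<otimes> n" "inv n" n p] inv_M_M[of n p] by (simp add: field_simps)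
qed

lemma MSM:
  assumes "m \<in> M" "a \<in> S" "n \<in> M"
  shows "w (m, a, n) = tau m * w (a, inv a \<otimes> inv m, m \<otimes> (a \<otimes> n)) / tau (m \<otimes> a)"
proof -
  note [simp] = assms assms(2)[THEN S_carrier] assms(1,3)[THEN M_carrier]
  show ?thesis
    using cocycle_eq[of "inv m" m a n] inv_M_M[of m "a \<otimes> n"] MMM[of "inv m" "m \<otimes> a" n]
    by (simp add: field_simps)
qed

lemma SSS:
  assumes "a \<in> S" "b \<in> S" "c \<in> S" "p \<in> M"
  shows "w (a, b, c) =
    w (a \<otimes> b, c, inv c \<otimes> (inv b \<otimes> (inv a \<otimes> p))) * w (a, b, inv b \<otimes> (inv a \<otimes> p)) /
      (w (b, c, inv c \<otimes> (inv b \<otimes> (inv a \<otimes> p))) *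
       w (a, b \<otimes> c, inv c \<otimes> (inv b \<otimes> (inv a \<otimes> p))))"
proof -
  note [simp] = assms assms(1-3)[THEN S_carrier] assms(4)[THEN M_carrier]
  show ?thesis
    using cocycle_eq[of a b c "inv c \<otimes> (inv b \<otimes> (inv a \<otimes> p))"] by (simp add: field_simps)
qed

lemma assemble_components: "assemble (components w) = w"
proof (rule cochain_eqI)
  show "w \<in> extensional (carrier G \<times> carrier G \<times> carrier G)"
    using reduced by (simp add: reduced_def)
  show "assemble (components w) \<in> extensional (carrier G \<times> carrier G \<times> carrier G)"
    by (simp add: assemble_def components_def)
  show "assemble (components w) (x, y, z) = w (x, y, z)"
    if "x \<in> carrier G" "y \<in> carrier G" "z \<in> carrier G" for x y z
  proof -
    note [simp] = that M_carrier[OF base_point]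
    have "assemble (components w) (x, y, z) = w (x, y, z)" if "x \<in> S" "y \<in> S" "z \<in> S"
      using that SSS[OF that base_point] by (simp add: components_def assemble_def Let_def)
    with that show ?thesis
      by (elim carrier_cases)
        (simp_all add: components_def SMM[of x y z] MMS[of x y z] MSS[of x y z] MSM[of x y z] MMM[of x y z])
  qed
qed

lemma pointwise_ueberderivation_components:
  "pointwise_ueberderivation G S (fst (components w)) (fst (snd (components w))) (snd (snd (components w)))"
proof unfold_locales
  show "fst (components w) (a, b) m \<noteq> 0" "fst (snd (components w)) (a, b) m \<noteq> 0"
    if "a \<in> S" "b \<in> S" "m \<in> M" for a b m
    using that by (simp_all add: components_def S_carrier M_carrier)
  show "snd (snd (components w)) m \<noteq> 0" if "m \<in> M" for m
    using that by (simp add: components_def M_carrier)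
  show "fst (snd (components w)) (\<one>, a) m = 1" "fst (snd (components w)) (a, \<one>) m = 1"
    if "a \<in> S" "m \<in> M" for a m
    using that by (simp_all add: components_def S_carrier M_carrier)
  have tau_inv: "tau (inv m) = 1 / tau m" if "m \<in> M" for m
    using cocycle_eq[of "inv m" m "inv m" m] that by (simp add: M_carrier field_simps)
  then show "snd (snd (components w)) (inv m) = 1 / snd (snd (components w)) m" if "m \<in> M" for m
    using that by (simp add: components_def)
  fix a b m assume assms: "a \<in> S" "b \<in> S" "m \<in> M"
  note [simp] = assms assms(1-2)[THEN S_carrier] assms(3)[THEN M_carrier]
  \<comment> \<open>The exchange law compares two evaluations of the cocycle at \<open>(inv m \<otimes> inv a, a, m \<otimes> b)\<close>: the one in
    \<open>MSM\<close>, and the one given by the cocycle condition with the inverse of \<open>m \<otimes> b\<close> appended.\<close>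
  have "w (inv m \<otimes> inv a, a \<otimes> m \<otimes> b, inv b \<otimes> inv m) =
      tau (a \<otimes> m) * tau (m \<otimes> b) / (w (a, m, b) * tau m)"
    using cocycle_eq[of "inv m \<otimes> inv a" a "m \<otimes> b" "inv b \<otimes> inv m"]
      S_M_inv[of a "m \<otimes> b"]
      MSM[of "inv m \<otimes> inv a" a "m \<otimes> b"]
      MMM[of "inv m" "m \<otimes> b" "inv b \<otimes> inv m"]
      tau_inv[of m] tau_inv[of "a \<otimes> m"]
    by simp (simp add: field_simps)
  moreover have "w (b, inv b \<otimes> (inv m \<otimes> inv a), a) =
      tau (a \<otimes> m \<otimes> b) / w (inv m \<otimes> inv a, a \<otimes> m \<otimes> b, inv b \<otimes> inv m)"
    using MMM[of "inv m \<otimes> inv a" "a \<otimes> m \<otimes> b" "inv b \<otimes> inv m"]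
    by (simp add: field_simps)
  ultimately have "w (b, inv b \<otimes> (inv m \<otimes> inv a), a) =
      w (a, m, b) * (tau (a \<otimes> m \<otimes> b) * tau m) / (tau (a \<otimes> m) * tau (m \<otimes> b))"
    by simp
  then show "fst (components w) (b, a) (inv m) =
          fst (components w) (a, b) (a \<otimes> m \<otimes> b) *
          (snd (snd (components w)) (a \<otimes> m \<otimes> b) * snd (snd (components w)) m) /
          (snd (snd (components w)) (a \<otimes> m) * snd (snd (components w)) (m \<otimes> b))"
    by (simp add: components_def)
  fix c assume c: "c \<in> S"
  note [simp] = c S_carrier[OF c]
  show "fst (components w) (a \<otimes> b, c) m =
          fst (components w) (a, c) m * fst (components w) (b, c) (inv a \<otimes> m) *
            fst (snd (components w)) (a, b) (m \<otimes> inv c) / fst (snd (components w)) (a, b) m"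
    using cocycle_eq[of a b "inv b \<otimes> (inv a \<otimes> (m \<otimes> inv c))" c] by (simp add: components_def field_simps)
qed

end

section \<open>Ueberderivations and reduced cocycles\<close>

context pointwise_ueberderivation
begin

lemma chi_one:
  assumes "a \<in> S" "m \<in> M"
  shows "\<chi> (\<one>, a) m = 1" "\<chi> (a, \<one>) m = 1"
proof -
  have left: "\<chi> (\<one>, c) n = 1" if "c \<in> S" "n \<in> M" for c n
  proof -
    have "\<chi> (\<one> \<otimes> \<one>, c) n = \<chi> (\<one>, c) n * \<chi> (\<one>, c) n"
      by (subst chi_mult_left) (use that in \<open>simp_all add: upsilon_one M_carrier\<close>)
    then have "\<chi> (\<one>, c) n * \<chi> (\<one>, c) n = \<chi> (\<one>, c) n * 1"
      by (metis l_one one_closed mult.right_neutral)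
    with that show ?thesis
      by (metis mult_left_cancel chi_nonzero S_closed(1))
  qed
  show "\<chi> (\<one>, a) m = 1"
    using assms by (rule left)
  note [simp] = assms S_carrier[OF assms(1)] M_carrier[OF assms(2)]
  have "\<chi> (\<one>, a) (inv m \<otimes> a) = 1"
    by (rule left) simp_all
  then show "\<chi> (a, \<one>) m = 1"
    using chi_swap_inner[of a \<one> "inv a \<otimes> m"] by simp
qed

lemma reduced_assemble: "reduced (assemble (\<chi>, \<upsilon>, \<tau>))"
proof -
  note [simp] = S_carrier M_carrier upsilon_one chi_one
  let ?w = "assemble (\<chi>, \<upsilon>, \<tau>)"
  have "?w (x, \<one>, y) = 1" if "x \<in> carrier G" "y \<in> carrier G" for x y
    using that
    by (elim carrier_cases) (simp_all add: assemble_SSS[of _ _ _ base_point])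
  note mid = this
  have "?w (a, inv m, m) = 1" "?w (inv m, m, a) = 1" if "a \<in> S" "m \<in> M" for a m
    using that by simp_all
  with mid normalized_outer[OF cocycle_assemble mid] show ?thesis
    using cocycle_assemble by (simp add: reduced_def)
qed

end

context index_two_subgroup
begin

lemma coeff_ring_one [simp]: "\<one>\<^bsub>coeff_ring G S\<^esub> = (\<lambda>m\<in>M. 1)"
  by (simp add: coeff_ring_def M_def)

lemma Units_coeff_ring:
  "\<mu> \<in> Units (coeff_ring G S) \<longleftrightarrow> \<mu> \<in> extensional M \<and> (\<forall>m\<in>M. \<mu> m \<noteq> 0)"
proof
  assume "\<mu> \<in> Units (coeff_ring G S)"
  then obtain \<nu> where "\<mu> \<in> carrier (coeff_ring G S)"
    and "\<nu> \<otimes>\<^bsub>coeff_ring G S\<^esub> \<mu> = \<one>\<^bsub>coeff_ring G S\<^esub>"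
    unfolding Units_def by blast
  then have "\<mu> \<in> extensional M" and "(\<lambda>m\<in>M. \<nu> m * \<mu> m) = (\<lambda>m\<in>M. 1)"
    by (simp_all add: coeff_ring_def M_def PiE_def)
  moreover from fun_cong[OF this(2)] have "\<nu> m * \<mu> m = 1" if "m \<in> M" for m
    using that by (metis (no_types, lifting) restrict_apply)
  then have "\<forall>m\<in>M. \<mu> m \<noteq> 0"
    by fastforce
  ultimately show "\<mu> \<in> extensional M \<and> (\<forall>m\<in>M. \<mu> m \<noteq> 0)"
    by blast
next
  assume "\<mu> \<in> extensional M \<and> (\<forall>m\<in>M. \<mu> m \<noteq> 0)"
  then show "\<mu> \<in> Units (coeff_ring G S)"
    unfolding Units_def
    by (intro CollectI conjI bexI[of _ "\<lambda>m\<in>M. 1 / \<mu> m"])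
      (auto simp: coeff_ring_def M_def[symmetric] PiE_def intro!: restrict_ext)
qed

lemma act_apply [simp]: "m \<in> M \<Longrightarrow> act G S a \<mu> b m = \<mu> (inv a \<otimes> m \<otimes> inv b)"
  by (simp add: act_def M_def)

lemma bar_apply [simp]: "m \<in> M \<Longrightarrow> bar G S \<mu> m = \<mu> (inv m)"
  by (simp add: bar_def M_def)

lemma trivially_acting_eq:
  "trivially_acting G S (carrier (coeff_ring G S) :: ('a \<Rightarrow> 'f::field) set) = {\<one>}"
proof (intro equalityI subsetI)
  fix a assume "a \<in> trivially_acting G S (carrier (coeff_ring G S) :: ('a \<Rightarrow> 'f) set)"
  then have a: "a \<in> S"
    and fixed: "\<And>\<mu> :: 'a \<Rightarrow> 'f. \<mu> \<in> carrier (coeff_ring G S) \<Longrightarrow> act G S a \<mu> \<one> = \<mu>"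
    by (auto simp: trivially_acting_def)
  \<comment> \<open>The indicator function of one point detects that \<open>a\<close> moves this point.\<close>
  define \<mu> :: "'a \<Rightarrow> 'f" where "\<mu> = (\<lambda>m\<in>M. if m = base_point then 1 else 0)"
  note [simp] = a S_carrier[OF a] M_carrier[OF base_point]
  have "\<mu> \<in> carrier (coeff_ring G S)"
    by (simp add: \<mu>_def coeff_ring_def M_def)
  from fixed[OF this] have "act G S a \<mu> \<one> (a \<otimes> base_point) = \<mu> (a \<otimes> base_point)"
    by simp
  then have "\<mu> (a \<otimes> base_point) = 1"
    by (simp add: \<mu>_def)
  then have "a \<otimes> base_point = base_point"
    by (simp add: \<mu>_def split: if_splits)
  then show "a \<in> {\<one>}"
    by (simp add: r_cancel_one)
next
  fix a assume "a \<in> {\<one>}"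
  moreover have "act G S \<one> \<mu> \<one> = \<mu>" if "\<mu> \<in> carrier (coeff_ring G S)" for \<mu> :: "'a \<Rightarrow> 'f"
    using that by (intro extensionalityI[of _ "carrier G - S"]) (auto simp: act_def coeff_ring_def PiE_def)
  ultimately show "a \<in> trivially_acting G S (carrier (coeff_ring G S) :: ('a \<Rightarrow> 'f) set)"
    by (simp add: trivially_acting_def)
qed

lemma mem_ueberderivations_iff:
  fixes \<chi> \<upsilon> :: "'a \<times> 'a \<Rightarrow> 'a \<Rightarrow> 'f::field" and \<tau> :: "'a \<Rightarrow> 'f"
  shows "(\<chi>, \<upsilon>, \<tau>) \<in> ueberderivations G S \<longleftrightarrow>
    \<chi> \<in> extensional (S \<times> S) \<and> \<upsilon> \<in> extensional (S \<times> S) \<and> \<tau> \<in> extensional M \<and>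
    (\<forall>a\<in>S. \<forall>b\<in>S. \<chi> (a, b) \<in> extensional M \<and> \<upsilon> (a, b) \<in> extensional M) \<and>
    pointwise_ueberderivation G S \<chi> \<upsilon> \<tau>"
    (is "?L \<longleftrightarrow> ?x \<and> ?y \<and> ?t \<and> ?v \<and> ?ptw")
proof -
  note [simp] = S_carrier M_carrier
  have const: "\<mu> = (\<lambda>m\<in>M. 1) \<longleftrightarrow> (\<forall>m\<in>M. \<mu> m = 1)" if "\<mu> \<in> extensional M" for \<mu> :: "'a \<Rightarrow> 'f"
    using that by (auto intro: extensionalityI[of _ M])
  show ?thesis
  proof
    assume L: ?L
    then have mem: "\<chi> \<in> S \<times> S \<rightarrow>\<^sub>E Units (coeff_ring G S)" "\<upsilon> \<in> S \<times> S \<rightarrow>\<^sub>E Units (coeff_ring G S)"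
        "\<tau> \<in> Units (coeff_ring G S)"
      and one: "\<And>a. a \<in> S \<Longrightarrow> \<upsilon> (\<one>, a) = (\<lambda>m\<in>M. 1) \<and> \<upsilon> (a, \<one>) = (\<lambda>m\<in>M. 1)"
      and swap: "\<And>a b m. \<lbrakk>a \<in> S; b \<in> S; m \<in> M\<rbrakk> \<Longrightarrow> bar G S (\<chi> (b, a)) m =
          act G S (inv a) (\<chi> (a, b)) (inv b) m * ((act G S (inv a) \<tau> (inv b) m * \<tau> m) /
            (act G S (inv a) \<tau> \<one> m * act G S \<one> \<tau> (inv b) m))"
      and left: "\<And>a b c m. \<lbrakk>a \<in> S; b \<in> S; c \<in> S; m \<in> M\<rbrakk> \<Longrightarrow>
          \<upsilon> (a, b) m / act G S \<one> (\<upsilon> (a, b)) c m * \<chi> (a \<otimes> b, c) m =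
            \<chi> (a, c) m * act G S a (\<chi> (b, c)) \<one> m"
      and tau: "\<And>m. m \<in> M \<Longrightarrow> \<tau> m * \<tau> (inv m) = 1"
      by (auto simp: ueberderivations_def trivially_acting_eq M_def[symmetric])
    have units: "\<chi> (a, b) \<in> Units (coeff_ring G S)" "\<upsilon> (a, b) \<in> Units (coeff_ring G S)"
      if "a \<in> S" "b \<in> S" for a b
      using mem that by auto
    have nonzero: "\<chi> (a, b) m \<noteq> 0" "\<upsilon> (a, b) m \<noteq> 0" "\<tau> m \<noteq> 0"
      if "a \<in> S" "b \<in> S" "m \<in> M" for a b m
      using units[OF that(1,2)] mem(3) that(3) by (simp_all add: Units_coeff_ring)
    have "pointwise_ueberderivation G S \<chi> \<upsilon> \<tau>"
    proof unfold_locales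
      show "\<chi> (a, b) m \<noteq> 0" "\<upsilon> (a, b) m \<noteq> 0" if "a \<in> S" "b \<in> S" "m \<in> M" for a b m
        using nonzero that by blast+
      show "\<tau> m \<noteq> 0" if "m \<in> M" for m
        using nonzero that S_closed(1) by blast
      show "\<upsilon> (\<one>, a) m = 1" "\<upsilon> (a, \<one>) m = 1" if "a \<in> S" "m \<in> M" for a m
        using one[OF that(1)] that by simp_all
      show "\<chi> (b, a) (inv m) = \<chi> (a, b) (a \<otimes> m \<otimes> b) *
          (\<tau> (a \<otimes> m \<otimes> b) * \<tau> m) / (\<tau> (a \<otimes> m) * \<tau> (m \<otimes> b))"
        if "a \<in> S" "b \<in> S" "m \<in> M" for a b m
        using swap[OF that] that by simp
      show "\<chi> (a \<otimes> b, c) m =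
          \<chi> (a, c) m * \<chi> (b, c) (inv a \<otimes> m) * \<upsilon> (a, b) (m \<otimes> inv c) / \<upsilon> (a, b) m"
        if "a \<in> S" "b \<in> S" "c \<in> S" "m \<in> M" for a b c m
        using left[OF that] that nonzero by (simp add: field_simps)
      show "\<tau> (inv m) = 1 / \<tau> m" if "m \<in> M" for m
        using tau[OF that] nonzero[OF S_closed(1) S_closed(1) that] by (simp add: field_simps)
    qed
    with mem units show "?x \<and> ?y \<and> ?t \<and> ?v \<and> ?ptw"
      by (auto simp: PiE_def Units_coeff_ring)
  next
    assume R: "?x \<and> ?y \<and> ?t \<and> ?v \<and> ?ptw"
    then interpret pointwise_ueberderivation G S \<chi> \<upsilon> \<tau>
      by blast
    have "\<chi> \<in> S \<times> S \<rightarrow>\<^sub>E Units (coeff_ring G S)" "\<upsilon> \<in> S \<times> S \<rightarrow>\<^sub>E Units (coeff_ring G S)"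
        "\<tau> \<in> Units (coeff_ring G S)"
      using R by (auto simp: PiE_def Units_coeff_ring)
    moreover have "\<upsilon> (\<one>, a) = \<one>\<^bsub>coeff_ring G S\<^esub> \<and> \<upsilon> (a, \<one>) = \<one>\<^bsub>coeff_ring G S\<^esub>" if "a \<in> S" for a
      using that R upsilon_one by (simp add: const)
    moreover have "bar G S (\<chi> (b, a)) m =
        act G S (inv a) (\<chi> (a, b)) (inv b) m * ((act G S (inv a) \<tau> (inv b) m * \<tau> m) /
          (act G S (inv a) \<tau> \<one> m * act G S \<one> \<tau> (inv b) m))"
      if "a \<in> S" "b \<in> S" "m \<in> M" for a b m
      using chi_swap[OF that] that by simp
    moreover have "\<upsilon> (a, b) m / act G S \<one> (\<upsilon> (a, b)) c m * \<chi> (a \<otimes> b, c) m =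
        \<chi> (a, c) m * act G S a (\<chi> (b, c)) \<one> m"
      if "a \<in> S" "b \<in> S" "c \<in> S" "m \<in> M" for a b c m
      using chi_mult_left[OF that] that by simp
    ultimately show ?L
      using tau_inv
      by (auto simp: ueberderivations_def trivially_acting_eq M_def[symmetric])
  qed
qed

lemma ueberderivation_locale:
  assumes "(\<chi>, \<upsilon>, \<tau>) \<in> ueberderivations G S"
  shows "pointwise_ueberderivation G S \<chi> \<upsilon> \<tau>"
  using assms mem_ueberderivations_iff by blast

lemma reduced_assemble:
  assumes "u \<in> ueberderivations G S"
  shows "reduced (assemble u)"
  using assms ueberderivation_locale pointwise_ueberderivation.reduced_assemble
  by (cases u) blast

lemma components_ueberderivation:
  assumes "reduced w"
  shows "components w \<in> ueberderivations G S"
proof -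
  interpret reduced_cocycle G S w
    using assms by unfold_locales
  show ?thesis
    using pointwise_ueberderivation_components
    by (simp add: components_def mem_ueberderivations_iff)
qed

lemma assemble_components:
  "reduced w \<Longrightarrow> assemble (components w) = w"
  by (intro reduced_cocycle.assemble_components reduced_cocycle.intro reduced_cocycle_axioms.intro
      index_two_subgroup_axioms)

end

section \<open>Gauge transformations and coboundaries\<close>

context index_two_subgroup
begin

lemma ueberderivation_eqI:
  assumes "(\<chi>, \<upsilon>, \<tau>) \<in> ueberderivations G S" "(\<chi>', \<upsilon>', \<tau>') \<in> ueberderivations G S"
    and "\<And>a b m. \<lbrakk>a \<in> S; b \<in> S; m \<in> M\<rbrakk> \<Longrightarrow> \<chi> (a, b) m = \<chi>' (a, b) m"
    and "\<And>a b m. \<lbrakk>a \<in> S; b \<in> S; m \<in> M\<rbrakk> \<Longrightarrow> \<upsilon> (a, b) m = \<upsilon>' (a, b) m"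
    and "\<And>m. m \<in> M \<Longrightarrow> \<tau> m = \<tau>' m"
  shows "(\<chi>, \<upsilon>, \<tau>) = (\<chi>', \<upsilon>', \<tau>')"
proof -
  have "\<chi> (a, b) = \<chi>' (a, b)" "\<upsilon> (a, b) = \<upsilon>' (a, b)" if "a \<in> S" "b \<in> S" for a b
    using assms that unfolding mem_ueberderivations_iff
    by (auto intro!: extensionalityI[of _ M])
  then have "\<chi> = \<chi>'" "\<upsilon> = \<upsilon>'"
    using assms(1,2) unfolding mem_ueberderivations_iff
    by (auto intro!: extensionalityI[of _ "S \<times> S"])
  moreover have "\<tau> = \<tau>'"
    using assms(1,2,5) unfolding mem_ueberderivations_iff
    by (auto intro!: extensionalityI[of _ M])
  ultimately show ?thesis by simp
qed

text \<open>\<open>S\<close> acts transitively on \<open>M\<close>, so the values of \<open>\<theta>\<close> in a gauge transformation are scalars, like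
  the values of a 2-cochain.\<close>

lemma fixed_function_const:
  assumes "\<mu> \<in> fixed_functions G S" "m \<in> M"
  shows "\<mu> m = \<mu> base_point"
proof -
  note [simp] = assms(2) M_carrier[OF assms(2)] M_carrier[OF base_point]
  have "act G S \<one> \<mu> (inv m \<otimes> base_point) = \<mu>"
    using assms(1) by (simp add: fixed_functions_def)
  then have "act G S \<one> \<mu> (inv m \<otimes> base_point) base_point = \<mu> base_point"
    by simp
  then show ?thesis by simp
qed

lemma const_fixed_function: "(\<lambda>m\<in>M. c) \<in> fixed_functions G S"
proof -
  have "act G S a (\<lambda>m\<in>M. c) \<one> = (\<lambda>m\<in>M. c)" "act G S \<one> (\<lambda>m\<in>M. c) a = (\<lambda>m\<in>M. c)"
    if "a \<in> S" for a
    using that by (auto simp: act_def M_def[symmetric] M_carrier S_carrier intro!: restrict_ext)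
  then show ?thesis
    by (simp add: fixed_functions_def coeff_ring_def M_def[symmetric])
qed

text \<open>A gauge transformation prescribes a 2-cochain on \<open>S \<times> S\<close>, on \<open>S \<times> M\<close> and at all \<open>(inv m, m)\<close>, and
  there is one way to extend it so that the twist of a reduced cocycle remains reduced. The twisted
  cocycle is then determined by its components, which are given by the gauge equations.\<close>

lemma twist_of_gauge:
  assumes u: "(\<chi>, \<upsilon>, \<tau>) \<in> ueberderivations G S"
    and u': "(\<chi>', \<upsilon>', \<tau>') \<in> ueberderivations G S"
    and gauge: "gauge_transformation G S (\<theta>, \<phi>, \<sigma>) (\<chi>, \<upsilon>, \<tau>) (\<chi>', \<upsilon>', \<tau>')"
  obtains f where "unit_cochain f"
    "assemble (\<chi>', \<upsilon>', \<tau>') = twist f (assemble (\<chi>, \<upsilon>, \<tau>))"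
proof
  note [simp] = S_carrier M_carrier
  interpret u: pointwise_ueberderivation G S \<chi> \<upsilon> \<tau>
    by (rule ueberderivation_locale[OF u])
  interpret u': pointwise_ueberderivation G S \<chi>' \<upsilon>' \<tau>'
    by (rule ueberderivation_locale[OF u'])
  from gauge have mem: "\<theta> \<in> S \<times> S \<rightarrow>\<^sub>E fixed_functions G S \<inter> Units (coeff_ring G S)"
      "\<phi> \<in> S \<rightarrow>\<^sub>E Units (coeff_ring G S)" "\<sigma> \<in> Units (coeff_ring G S)"
    and phi_one': "\<phi> \<one> = \<one>\<^bsub>coeff_ring G S\<^esub>"
    and chi_ratio: "\<And>a b m. \<lbrakk>a \<in> S; b \<in> S; m \<in> M\<rbrakk> \<Longrightarrow> \<chi>' (a, b) m / \<chi> (a, b) m =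
      (\<phi> a m * act G S a (bar G S (\<phi> b)) b m * act G S a \<sigma> b m * \<sigma> m) /
        (act G S \<one> (\<phi> a) b m * act G S \<one> (bar G S (\<phi> b)) b m * act G S a \<sigma> \<one> m * act G S \<one> \<sigma> b m)"
    and upsilon_ratio: "\<And>a b m. \<lbrakk>a \<in> S; b \<in> S; m \<in> M\<rbrakk> \<Longrightarrow> \<upsilon>' (a, b) m / \<upsilon> (a, b) m =
      (\<phi> a m * act G S a (\<phi> b) \<one> m) / (\<phi> (a \<otimes> b) m * \<theta> (a, b) m)"
    and tau_ratio: "\<And>m. m \<in> M \<Longrightarrow> \<tau>' m / \<tau> m = bar G S \<sigma> m / \<sigma> m"
    unfolding gauge_transformation_def prod.case M_def[symmetric] by blast+
  have phi_one: "\<phi> \<one> = (\<lambda>m\<in>M. 1)"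
    using phi_one' by simp
  have theta_fixed: "\<theta> (a, b) \<in> fixed_functions G S"
    and theta_unit: "\<theta> (a, b) \<in> Units (coeff_ring G S)" if "a \<in> S" "b \<in> S" for a b
    using mem(1) that by auto
  have theta: "\<theta> (a, b) m = \<theta> (a, b) base_point" if "a \<in> S" "b \<in> S" "m \<in> M" for a b m
    using fixed_function_const theta_fixed that by blast
  have phi_unit: "\<phi> a \<in> Units (coeff_ring G S)" if "a \<in> S" for a
    using mem(2) that by auto
  have nz [simp]: "\<lbrakk>a \<in> S; b \<in> S; m \<in> M\<rbrakk> \<Longrightarrow> \<theta> (a, b) m \<noteq> 0"
    "\<lbrakk>a \<in> S; m \<in> M\<rbrakk> \<Longrightarrow> \<phi> a m \<noteq> 0" "m \<in> M \<Longrightarrow> \<sigma> m \<noteq> 0" for a b m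
    using theta_unit[of a b] phi_unit[of a] mem(3) by (simp_all add: Units_coeff_ring)
  have chi': "\<chi>' (a, b) m =
      (\<phi> a m * \<phi> b (b \<otimes> (inv m \<otimes> a)) * \<sigma> (inv a \<otimes> (m \<otimes> inv b)) * \<sigma> m) /
       (\<phi> a (m \<otimes> inv b) * \<phi> b (b \<otimes> inv m) * \<sigma> (inv a \<otimes> m) * \<sigma> (m \<otimes> inv b)) * \<chi> (a, b) m"
    if "a \<in> S" "b \<in> S" "m \<in> M" for a b m
    using iffD1[OF nonzero_divide_eq_eq[OF u.chi_nonzero[OF that]] chi_ratio[OF that]] that by simp
  have upsilon': "\<upsilon>' (a, b) m =
      (\<phi> a m * \<phi> b (inv a \<otimes> m)) / (\<phi> (a \<otimes> b) m * \<theta> (a, b) base_point) * \<upsilon> (a, b) m"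
    if "a \<in> S" "b \<in> S" "m \<in> M" for a b m
    using iffD1[OF nonzero_divide_eq_eq[OF u.upsilon_nonzero[OF that]] upsilon_ratio[OF that]] that
    by (simp add: theta[OF that])
  have tau': "\<tau>' m = \<sigma> (inv m) / \<sigma> m * \<tau> m" if "m \<in> M" for m
    using iffD1[OF nonzero_divide_eq_eq[OF u.tau_nonzero[OF that]] tau_ratio[OF that]] that by simp
  have theta_one: "\<theta> (\<one>, a) base_point = 1" "\<theta> (a, \<one>) base_point = 1" if "a \<in> S" for a
    using upsilon'[of \<one> a base_point] upsilon'[of a \<one> base_point] that
    by (simp_all add: phi_one u.upsilon_one u'.upsilon_one)
  \<comment> \<open>The values on \<open>M \<times> M\<close> and on \<open>M \<times> S\<close> keep the cocycle trivial at \<open>(a, inv m, m)\<close> and at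
    \<open>(inv m, m, a)\<close>, respectively.\<close>
  define f where "f = (\<lambda>(x, y).
    if x \<in> S then (if y \<in> S then \<theta> (x, y) base_point else \<phi> x (x \<otimes> y))
    else (if y \<in> S then \<sigma> x * \<phi> y (inv x) / \<sigma> (x \<otimes> y) else \<sigma> y / \<phi> (x \<otimes> y) x))"
  have f [simp]:
    "\<lbrakk>a \<in> S; b \<in> S\<rbrakk> \<Longrightarrow> f (a, b) = \<theta> (a, b) base_point"
    "\<lbrakk>a \<in> S; m \<in> M\<rbrakk> \<Longrightarrow> f (a, m) = \<phi> a (a \<otimes> m)"
    "\<lbrakk>a \<in> S; m \<in> M\<rbrakk> \<Longrightarrow> f (m, a) = \<sigma> m * \<phi> a (inv m) / \<sigma> (m \<otimes> a)"
    "\<lbrakk>m \<in> M; n \<in> M\<rbrakk> \<Longrightarrow> f (m, n) = \<sigma> n / \<phi> (m \<otimes> n) m" for a b m n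
    by (simp_all add: f_def M_not_S)
  show unit: "unit_cochain f"
    unfolding unit_cochain_def by (auto elim!: carrier_cases)
  let ?w = "assemble (\<chi>, \<upsilon>, \<tau>)"
  have cocycle: "cocycle (twist f ?w)"
    by (rule cocycle_twist[OF u.cocycle_assemble unit])
  have f_one: "f (\<one>, x) = 1" "f (x, \<one>) = 1" if "x \<in> carrier G" for x
    using that by (elim carrier_cases; simp add: phi_one theta_one)+
  have w_one: "?w (x, \<one>, y) = 1" if "x \<in> carrier G" "y \<in> carrier G" for x y
    using u.reduced_assemble that by (simp add: reduced_def)
  have mid: "twist f ?w (x, \<one>, y) = 1" if "x \<in> carrier G" "y \<in> carrier G" for x y
    using that unit_cochain_nonzero[OF unit that] by (simp del: f add: f_one w_one)
  have "twist f ?w (a, inv m, m) = 1" "twist f ?w (inv m, m, a) = 1" if "a \<in> S" "m \<in> M" for a m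
    using that by (simp_all add: phi_one theta_one u.upsilon_one)
  with cocycle mid normalized_outer[OF cocycle mid] have reduced: "reduced (twist f ?w)"
    by (simp add: reduced_def)
  have "components (twist f ?w) = (\<chi>', \<upsilon>', \<tau>')"
    unfolding components_def
  proof (rule ueberderivation_eqI[OF _ u'])
    show "(\<lambda>(a, b)\<in>S \<times> S. \<lambda>m\<in>M. twist f ?w (a, inv a \<otimes> m \<otimes> inv b, b),
           \<lambda>(a, b)\<in>S \<times> S. \<lambda>m\<in>M. twist f ?w (a, b, inv b \<otimes> inv a \<otimes> m),
           \<lambda>m\<in>M. twist f ?w (inv m, m, inv m)) \<in> ueberderivations G S"
      using components_ueberderivation[OF reduced] by (simp add: components_def)
  qed (simp_all add: chi' upsilon' tau' phi_one theta_one u.chi_one, simp_all add: field_simps)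
  then show "assemble (\<chi>', \<upsilon>', \<tau>') = twist f ?w"
    using assemble_components[OF reduced] by simp
qed

text \<open>Between normalized cocycles, \<open>f\<close> is constant on all pairs with an entry \<open>\<one>\<close>, and dividing by that
  constant does not change the coboundary.\<close>

lemma twist_normalize:
  assumes w: "reduced w" and w': "reduced (twist g w)" and g: "unit_cochain g"
  obtains f where "unit_cochain f" "twist f w = twist g w"
    "\<And>x. x \<in> carrier G \<Longrightarrow> f (\<one>, x) = 1" "\<And>x. x \<in> carrier G \<Longrightarrow> f (x, \<one>) = 1"
proof
  note nz [simp] = unit_cochain_nonzero[OF g]
  define f where "f p = g p / g (\<one>, \<one>)" for p
  show "unit_cochain f"
    using g by (simp add: unit_cochain_def f_def)
  show "twist f w = twist g w"
    by (rule cochain_eqI) (simp_all add: f_def)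
  have one: "w (x, \<one>, y) = 1" "twist g w (x, \<one>, y) = 1"
    if "x \<in> carrier G" "y \<in> carrier G" for x y
    using w w' that by (simp_all add: reduced_def del: twist_apply)
  show "f (\<one>, x) = 1" "f (x, \<one>) = 1" if "x \<in> carrier G" for x
    using one[of \<one> x] one[of x \<one>] that by (simp_all add: f_def)
qed

text \<open>Conversely, if the coboundary of \<open>f\<close> relates two reduced cocycles, then \<open>f\<close>, once normalized, is
  determined by the values that form a gauge transformation. In \<open>MM\<close> and \<open>MS\<close> the other values are expressed by these;
  substituting them into the coboundary gives the gauge equations.\<close>

lemma gauge_of_twist:
  assumes u: "(\<chi>, \<upsilon>, \<tau>) \<in> ueberderivations G S"
    and u': "(\<chi>', \<upsilon>', \<tau>') \<in> ueberderivations G S"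
    and g: "unit_cochain g" "assemble (\<chi>', \<upsilon>', \<tau>') = twist g (assemble (\<chi>, \<upsilon>, \<tau>))"
  obtains t where "gauge_transformation G S t (\<chi>, \<upsilon>, \<tau>) (\<chi>', \<upsilon>', \<tau>')"
proof -
  note [simp] = S_carrier M_carrier
  interpret u: pointwise_ueberderivation G S \<chi> \<upsilon> \<tau>
    by (rule ueberderivation_locale[OF u])
  interpret u': pointwise_ueberderivation G S \<chi>' \<upsilon>' \<tau>'
    by (rule ueberderivation_locale[OF u'])
  let ?w = "assemble (\<chi>, \<upsilon>, \<tau>)"
  let ?w' = "assemble (\<chi>', \<upsilon>', \<tau>')"
  have "reduced (twist g ?w)"
    using u'.reduced_assemble g(2) by simp
  then obtain f where unit: "unit_cochain f" and "twist f ?w = twist g ?w"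
    and f_one: "\<And>x. x \<in> carrier G \<Longrightarrow> f (\<one>, x) = 1" "\<And>x. x \<in> carrier G \<Longrightarrow> f (x, \<one>) = 1"
    using twist_normalize[OF u.reduced_assemble _ g(1)] by blast
  with g(2) have w': "?w' (x, y, z) = ?w (x, y, z) * (f (y, z) * f (x, y \<otimes> z) / (f (x \<otimes> y, z) * f (x, y)))"
    if "x \<in> carrier G" "y \<in> carrier G" "z \<in> carrier G" for x y z
    using that by (metis twist_apply)
  note nz [simp] = unit_cochain_nonzero[OF unit]
  have MM: "f (a \<otimes> inv n, n) = f (inv n, n) / f (a, inv n)" if "a \<in> S" "n \<in> M" for a n
    using w'[of a "inv n" n] that
    by (simp add: f_one u.upsilon_one u'.upsilon_one field_simps)
  have MS: "f (n, a) = f (inv n, n) * f (a, inv a \<otimes> inv n) / f (inv a \<otimes> inv n, n \<otimes> a)"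
    if "a \<in> S" "n \<in> M" for a n
    using w'[of "inv n" n a] MM[of a "n \<otimes> a"] that
    by (simp add: f_one u.upsilon_one u'.upsilon_one) (simp add: field_simps)
  define \<theta> where "\<theta> = (\<lambda>(a, b)\<in>S \<times> S. \<lambda>m\<in>M. f (a, b))"
  define \<phi> where "\<phi> = (\<lambda>a\<in>S. \<lambda>m\<in>M. f (a, inv a \<otimes> m))"
  define \<sigma> where "\<sigma> = (\<lambda>m\<in>M. f (inv m, m))"
  have "gauge_transformation G S (\<theta>, \<phi>, \<sigma>) (\<chi>, \<upsilon>, \<tau>) (\<chi>', \<upsilon>', \<tau>')"
    unfolding gauge_transformation_def prod.case M_def[symmetric]
  proof (intro conjI ballI)
    show "\<theta> \<in> S \<times> S \<rightarrow>\<^sub>E fixed_functions G S \<inter> Units (coeff_ring G S)"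
      by (auto simp: \<theta>_def const_fixed_function Units_coeff_ring)
    show "\<phi> \<in> S \<rightarrow>\<^sub>E Units (coeff_ring G S)"
      by (auto simp: \<phi>_def Units_coeff_ring)
    show "\<sigma> \<in> Units (coeff_ring G S)"
      by (simp add: \<sigma>_def Units_coeff_ring)
    show "\<phi> \<one> = \<one>\<^bsub>coeff_ring G S\<^esub>"
      by (auto simp: \<phi>_def f_one intro!: restrict_ext)
    show "\<tau>' m / \<tau> m = bar G S \<sigma> m / \<sigma> m" if "m \<in> M" for m
      using w'[of "inv m" m "inv m"] that
      by (simp add: \<sigma>_def f_one u.chi_one u'.chi_one)
    show "\<upsilon>' (a, b) m / \<upsilon> (a, b) m =
        (\<phi> a m * act G S a (\<phi> b) \<one> m) / (\<phi> (a \<otimes> b) m * \<theta> (a, b) m)"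
      if "a \<in> S" "b \<in> S" "m \<in> M" for a b m
      using w'[of a b "inv b \<otimes> (inv a \<otimes> m)"] that
      by (simp add: \<phi>_def \<theta>_def mult_ac)
    show "\<chi>' (a, b) m / \<chi> (a, b) m =
        (\<phi> a m * act G S a (bar G S (\<phi> b)) b m * act G S a \<sigma> b m * \<sigma> m) /
          (act G S \<one> (\<phi> a) b m * act G S \<one> (bar G S (\<phi> b)) b m * act G S a \<sigma> \<one> m * act G S \<one> \<sigma> b m)"
      if "a \<in> S" "b \<in> S" "m \<in> M" for a b m
      using w'[of a "inv a \<otimes> (m \<otimes> inv b)" b] MS[of b "inv a \<otimes> (m \<otimes> inv b)"] MS[of b "m \<otimes> inv b"] that
      by (simp add: \<phi>_def \<sigma>_def mult_ac)
  qed
  then show thesis by (rule that)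
qed

end

section \<open>Cohomology classes\<close>

lemma field_units_simps [simp]:
  "carrier (field_units :: 'f::field monoid) = {x. x \<noteq> 0}"
  "monoid.mult (field_units :: 'f monoid) = (*)"
  "\<one>\<^bsub>(field_units :: 'f monoid)\<^esub> = 1"
  by (auto simp: field_units_def mult_of_def ring_of_type_algebra_def)

lemma group_field_units: "group (field_units :: 'f::field monoid)"
proof (rule groupI)
  show "\<exists>y\<in>carrier field_units. y \<otimes>\<^bsub>field_units\<^esub> x = \<one>\<^bsub>field_units\<^esub>"
    if "x \<in> carrier field_units" for x :: 'f
    using that by (intro bexI[of _ "inverse x"]) simp_all
qed simp_all

lemma inv_field_units [simp]:
  assumes "x \<noteq> 0"
  shows "inv\<^bsub>field_units\<^esub> x = inverse (x :: 'f::field)"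
  using assms by (intro group.inv_equality[OF group_field_units]) simp_all

context index_two_subgroup
begin

abbreviation cocycles :: "('a \<times> 'a \<times> 'a \<Rightarrow> 'f::field) set" where
  "cocycles \<equiv> {w. w \<in> extensional (carrier G \<times> carrier G \<times> carrier G) \<and> cocycle w}"

lemma kernel_coboundary3:
  "kernel (cochains3 G field_units) (cochains4 G field_units) (coboundary3 G field_units) =
     (cocycles :: ('a \<times> 'a \<times> 'a \<Rightarrow> 'f::field) set)"
proof -
  have "w \<in> carrier (cochains3 G field_units) \<and> coboundary3 G field_units w = \<one>\<^bsub>cochains4 G field_units\<^esub> \<longleftrightarrow>
      w \<in> cocycles" (is "?L \<longleftrightarrow> _") for w :: "'a \<times> 'a \<times> 'a \<Rightarrow> 'f"
  proof -
    have carrier: "w \<in> carrier (cochains3 G field_units) \<longleftrightarrow>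
        w \<in> extensional (carrier G \<times> carrier G \<times> carrier G) \<and>
        (\<forall>x\<in>carrier G. \<forall>y\<in>carrier G. \<forall>z\<in>carrier G. w (x, y, z) \<noteq> 0)"
      by (auto simp: cochains3_def PiE_def)
    have "coboundary3 G field_units w = \<one>\<^bsub>cochains4 G field_units\<^esub> \<longleftrightarrow>
        (\<forall>x\<in>carrier G. \<forall>y\<in>carrier G. \<forall>z\<in>carrier G. \<forall>t\<in>carrier G. cocycle_at w x y z t)"
      if nz: "\<forall>x\<in>carrier G. \<forall>y\<in>carrier G. \<forall>z\<in>carrier G. w (x, y, z) \<noteq> 0"
    proof -
      have "coboundary3 G field_units w = \<one>\<^bsub>cochains4 G field_units\<^esub> \<longleftrightarrow>
          (\<forall>p \<in> carrier G \<times> carrier G \<times> carrier G \<times> carrier G. coboundary3 G field_units w p = 1)"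
        unfolding cochains4_def coboundary3_def by (auto simp: fun_eq_iff restrict_def)
      also have "\<dots> \<longleftrightarrow>
          (\<forall>x\<in>carrier G. \<forall>y\<in>carrier G. \<forall>z\<in>carrier G. \<forall>t\<in>carrier G. coboundary3 G field_units w (x, y, z, t) = 1)"
        by blast
      also have "\<dots> \<longleftrightarrow>
          (\<forall>x\<in>carrier G. \<forall>y\<in>carrier G. \<forall>z\<in>carrier G. \<forall>t\<in>carrier G. cocycle_at w x y z t)"
      proof (intro ball_cong refl)
        fix x y z t assume "x \<in> carrier G" "y \<in> carrier G" "z \<in> carrier G" "t \<in> carrier G"
        then show "coboundary3 G field_units w (x, y, z, t) = 1 \<longleftrightarrow> cocycle_at w x y z t"
          using nz by (simp add: coboundary3_def field_simps)
      qed
      finally show ?thesis .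
    qed
    then show ?thesis
      unfolding carrier by (auto simp: cocycle_def)
  qed
  then show ?thesis
    by (auto simp: kernel_def)
qed

abbreviation twist_class :: "('a \<times> 'a \<times> 'a \<Rightarrow> 'f::field) \<Rightarrow> ('a \<times> 'a \<times> 'a \<Rightarrow> 'f) set" where
  "twist_class w \<equiv> {twist f w | f. unit_cochain f}"

text \<open>The cosets that are the elements of \<open>cohomology3\<close> are the orbits of twisting; there \<open>K\<close> is the
  kernel of \<open>coboundary3\<close>.\<close>

lemma coset_coboundary2:
  fixes w :: "'a \<times> 'a \<times> 'a \<Rightarrow> 'f::field"
  shows "(coboundary2 G field_units ` carrier (cochains2 G field_units))
      #>\<^bsub>cochains3 G field_units\<lparr>carrier := K\<rparr>\<^esub> w = twist_class w"
proof -
  have mult: "coboundary2 G field_units f \<otimes>\<^bsub>cochains3 G field_units\<lparr>carrier := K\<rparr>\<^esub> w = twist f w"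
    if "unit_cochain f" for f
  proof (rule cochain_eqI)
    show "coboundary2 G field_units f \<otimes>\<^bsub>cochains3 G field_units\<lparr>carrier := K\<rparr>\<^esub> w
        \<in> extensional (carrier G \<times> carrier G \<times> carrier G)"
      by (simp add: cochains3_def)
    show "(coboundary2 G field_units f \<otimes>\<^bsub>cochains3 G field_units\<lparr>carrier := K\<rparr>\<^esub> w) (x, y, z)
        = twist f w (x, y, z)"
      if "x \<in> carrier G" "y \<in> carrier G" "z \<in> carrier G" for x y z
      using that unit_cochain_nonzero[OF \<open>unit_cochain f\<close>]
      by (simp add: cochains3_def coboundary2_def divide_simps)
  qed simp
  have carrier: "carrier (cochains2 G field_units) =
      {f. unit_cochain f \<and> f \<in> extensional (carrier G \<times> carrier G)}"
    by (auto simp: cochains2_def PiE_def unit_cochain_def)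
  show ?thesis
  proof (intro equalityI subsetI)
    fix v assume "v \<in> (coboundary2 G field_units ` carrier (cochains2 G field_units))
        #>\<^bsub>cochains3 G field_units\<lparr>carrier := K\<rparr>\<^esub> w"
    then show "v \<in> twist_class w"
      unfolding r_coset_def carrier using mult by auto
  next
    fix v assume "v \<in> twist_class w"
    then obtain f where f: "unit_cochain f" "v = twist f w"
      by blast
    define g where "g = restrict f (carrier G \<times> carrier G)"
    have g: "unit_cochain g"
      using f(1) by (simp add: unit_cochain_def g_def)
    have "twist g w = twist f w"
      by (rule cochain_eqI) (simp_all add: g_def)
    with f(2) mult[OF g] have
      "v = coboundary2 G field_units g \<otimes>\<^bsub>cochains3 G field_units\<lparr>carrier := K\<rparr>\<^esub> w"
      by simp
    moreover have "g \<in> carrier (cochains2 G field_units)"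
      unfolding carrier using g by (simp add: g_def)
    ultimately show "v \<in> (coboundary2 G field_units ` carrier (cochains2 G field_units))
        #>\<^bsub>cochains3 G field_units\<lparr>carrier := K\<rparr>\<^esub> w"
      unfolding r_coset_def by blast
  qed
qed

lemma carrier_cohomology3:
  "carrier (cohomology3 G field_units) = twist_class ` (cocycles :: ('a \<times> 'a \<times> 'a \<Rightarrow> 'f::field) set)"
  unfolding cohomology3_def kernel_coboundary3 FactGroup_def RCOSETS_def coset_coboundary2
  by auto

lemma twist_class_eq_iff:
  fixes w w' :: "'a \<times> 'a \<times> 'a \<Rightarrow> 'f::field"
  assumes "w' \<in> extensional (carrier G \<times> carrier G \<times> carrier G)"
  shows "twist_class w = twist_class w' \<longleftrightarrow> (\<exists>f. unit_cochain f \<and> w' = twist f w)"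
proof
  assume "twist_class w = twist_class w'"
  moreover have "unit_cochain (\<lambda>_. 1 :: 'f)"
    by (simp add: unit_cochain_def)
  then have "w' \<in> twist_class w'"
    using twist_one[OF assms, symmetric] by blast
  ultimately show "\<exists>f. unit_cochain f \<and> w' = twist f w"
    by blast
next
  assume "\<exists>f. unit_cochain f \<and> w' = twist f w"
  then obtain f where f: "unit_cochain f" and w': "w' = twist f w"
    by blast
  show "twist_class w = twist_class w'"
  proof (intro equalityI subsetI)
    fix v assume "v \<in> twist_class w'"
    then obtain g where g: "unit_cochain g" "v = twist g (twist f w)"
      using w' by blast
    then have "v = twist (\<lambda>p. f p * g p) w" "unit_cochain (\<lambda>p. f p * g p)"
      using f twist_twist[OF f g(1)] by (simp_all add: unit_cochain_def)
    then show "v \<in> twist_class w" by blast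
  next
    fix v assume "v \<in> twist_class w"
    then obtain g where g: "unit_cochain g" "v = twist g w"
      by blast
    have quot: "unit_cochain (\<lambda>p. g p / f p)"
      using f g(1) by (simp add: unit_cochain_def)
    have "twist (\<lambda>p. g p / f p) w' = v"
      unfolding w' g(2)
      by (rule cochain_eqI) (use f in \<open>simp_all add: unit_cochain_def\<close>)
    with quot show "v \<in> twist_class w'" by blast
  qed
qed

text \<open>Gauge equivalence is the kernel of the map that sends an ueberderivation to the class of its
  cocycle; in particular it is an equivalence relation.\<close>

lemma gauge_equivalence_eq:
  "(gauge_equivalence G S ::
      ((('a \<times> 'a \<Rightarrow> 'a \<Rightarrow> 'f::field) \<times> ('a \<times> 'a \<Rightarrow> 'a \<Rightarrow> 'f) \<times> ('a \<Rightarrow> 'f)) \<times>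
       (('a \<times> 'a \<Rightarrow> 'a \<Rightarrow> 'f) \<times> ('a \<times> 'a \<Rightarrow> 'a \<Rightarrow> 'f) \<times> ('a \<Rightarrow> 'f))) set) =
     {(u, u'). u \<in> ueberderivations G S \<and> u' \<in> ueberderivations G S \<and>
        twist_class (assemble u) = twist_class (assemble u')}"
proof -
  have "(\<exists>t. gauge_transformation G S t u u') \<longleftrightarrow>
      (\<exists>f. unit_cochain f \<and> assemble u' = twist f (assemble u))"
    if "u \<in> ueberderivations G S" "u' \<in> ueberderivations G S"
    for u u' :: "('a \<times> 'a \<Rightarrow> 'a \<Rightarrow> 'f) \<times> ('a \<times> 'a \<Rightarrow> 'a \<Rightarrow> 'f) \<times> ('a \<Rightarrow> 'f)"
  proof -
    obtain \<chi> \<upsilon> \<tau> \<chi>' \<upsilon>' \<tau>' where u: "u = (\<chi>, \<upsilon>, \<tau>)" "u' = (\<chi>', \<upsilon>', \<tau>')"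
      by (cases u, cases u')
    show ?thesis
    proof
      assume "\<exists>t. gauge_transformation G S t u u'"
      then obtain \<theta> \<phi> \<sigma> where "gauge_transformation G S (\<theta>, \<phi>, \<sigma>) u u'"
        by (metis prod_cases3)
      then show "\<exists>f. unit_cochain f \<and> assemble u' = twist f (assemble u)"
        using that twist_of_gauge unfolding u by metis
    next
      assume "\<exists>f. unit_cochain f \<and> assemble u' = twist f (assemble u)"
      then show "\<exists>t. gauge_transformation G S t u u'"
        using that gauge_of_twist unfolding u by metis
    qed
  qed
  then show ?thesis
    unfolding gauge_equivalence_def twist_class_eq_iff[OF assemble_extensional]
    by blast
qed

lemma twist_class_assemble_image:
  "(\<lambda>u. twist_class (assemble u)) ` ueberderivations G S =
     carrier (cohomology3 G (field_units :: 'f::field monoid))"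
  unfolding carrier_cohomology3
proof (intro equalityI subsetI)
  fix c :: "('a \<times> 'a \<times> 'a \<Rightarrow> 'f) set"
  assume "c \<in> (\<lambda>u. twist_class (assemble u)) ` ueberderivations G S"
  then obtain u where c: "c = twist_class (assemble u)" and "u \<in> ueberderivations G S"
    by blast
  then have "assemble u \<in> cocycles"
    using reduced_assemble reduced_def by blast
  with c show "c \<in> twist_class ` cocycles"
    by blast
next
  fix c :: "('a \<times> 'a \<times> 'a \<Rightarrow> 'f) set"
  assume "c \<in> twist_class ` cocycles"
  then obtain w where c: "c = twist_class w" and w: "cocycle w"
    by blast
  obtain f where f: "unit_cochain f" and red: "reduced (twist f w)"
    using exists_reduced[OF w] by blast
  have "c = twist_class (twist f w)"
    unfolding c using f twist_class_eq_iff[OF twist_extensional] by blast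
  then have "c = twist_class (assemble (components (twist f w)))"
    by (simp add: assemble_components[OF red])
  with components_ueberderivation[OF red]
  show "c \<in> (\<lambda>u. twist_class (assemble u)) ` ueberderivations G S"
    by blast
qed

end

section \<open>The classification\<close>

lemma bij_betw_quotient_kernel:
  assumes "r = {(x, y). x \<in> A \<and> y \<in> A \<and> f x = f y}"
  shows "bij_betw (\<lambda>c. {x \<in> A. f x = c}) (f ` A) (A // r)"
proof (rule bij_betw_imageI)
  show "inj_on (\<lambda>c. {x \<in> A. f x = c}) (f ` A)"
    by (rule inj_onI) blast
  have "r `` {x} = {y \<in> A. f y = f x}" if "x \<in> A" for x
    using that assms by auto
  then show "(\<lambda>c. {x \<in> A. f x = c}) ` f ` A = A // r"
    by (auto simp: quotient_def)
qed

theorem corollary4p8: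
  fixes G :: "('g, 'x) monoid_scheme" and S :: "'g set"
  assumes "group G"
    and "subgroup S G"
    and "card (rcosets\<^bsub>G\<^esub> S) = 2"
  shows "\<exists>\<Phi>. bij_betw \<Phi>
    (carrier (cohomology3 G (field_units :: 'f::field monoid)))
    ((ueberderivations G S ::
        (('g \<times> 'g \<Rightarrow> 'g \<Rightarrow> 'f) \<times> ('g \<times> 'g \<Rightarrow> 'g \<Rightarrow> 'f) \<times> ('g \<Rightarrow> 'f)) set)
      // gauge_equivalence G S)"
proof -
  interpret index_two_subgroup G S
    using assms by (rule index_two_subgroupI)
  show ?thesis
    using bij_betw_quotient_kernel[OF gauge_equivalence_eq]
    unfolding twist_class_assemble_image by blast
qed

end
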